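(* Let $F:\mathbb{B}^N\to\mathbb{B}^N$ be a holomorphic selfmap of the open unit ball of $\mathbb{C}^N$. Then $F$ is a biholomorphism (of $\mathbb{B}^N$ onto $\mathbb{B}^N$) if and only if for every $v=(v_1,\dots,v_N)\in\mathbb{C}^N$ with $|v|=1$ and $v_1\neq 0$ the following two conditions hold: (a) if $\{z_k\}\subset \mathbb{B}^N\cap(\mathbb{C}v+e_1)$ is a sequence converging to $e_1$ non-tangentially such that $\{F(z_k)\}$ has no accumulation points in $\mathbb{B}^N$, then $$\limsup_{k\to\infty}\big|\Pi_{\pi(F(z_k))}\big(dF_{z_k}(v)\big)\big|<+\infty;$$ (b) as $z\to e_1$ non-tangentially with $z\in\mathbb{B}^N\cap(\mathbb{C}v+e_1)$, $$k_{\mathbb{B}^N}(F(z);dF_z(v))=k_{\mathbb{B}^N}(z;v)+o\big(\delta_{\mathbb{B}^N}(z)\big).$$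
   Context: $\mathbb{B}^N=\{z\in\mathbb{C}^N:|z|<1\}$ with the Euclidean norm; $e_1=(1,0,\dots,0)$; $\langle v,p\rangle=\sum_{j=1}^N v_j\overline{p_j}$. For $p\in\partial\mathbb{B}^N$ the complex tangent space is $T_p^{\mathbb{C}}\partial\mathbb{B}^N=\{v\in\mathbb{C}^N:\langle v,p\rangle=0\}$, and $\Pi_p(v)$ denotes the orthogonal projection of $v$ onto $T_p^{\mathbb{C}}\partial\mathbb{B}^N$. For $z\in\mathbb{B}^N\setminus\{0\}$, $\pi(z)\in\partial\mathbb{B}^N$ is the closest point of $\partial\mathbb{B}^N$ to $z$. $\delta_D(z)=\inf\{|z-w|:w\in\mathbb{C}^N\setminus D\}$ for a domain $D\subset\mathbb{C}^N$ and $z\in D$. $k_D(z;v)$ is the infinitesimal Kobayashi metric of $D$, $k_D(z;v)=\inf\{|\xi|:\xi\in\mathbb{C},\ \exists f:\mathbb{D}\to D \text{ holomorphic},\ f(0)=z,\ \xi f'(0)=v\}$, normalized so that on the unit disk $\mathbb{D}$ one has $k_{\mathbb{D}}(z;v)=|v|/(1-|z|^2)$. Convergence $z\to e_1$ non-tangentially means convergence within a region $\{z\in\mathbb{B}^N:|z-e_1|\le M\,\delta_{\mathbb{B}^N}(z)\}$ for some $M>1$; an asymptotic relation holds non-tangentially if it holds within each such region. $dF_z$ is the complex differential of $F$ at $z$. *)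

theory Defs
  imports "HOL-Complex_Analysis.Complex_Analysis" "HOL-Library.Landau_Symbols"
begin

abbreviation unit_ball :: "(complex ^ 'n) set" where
  "unit_ball \<equiv> ball 0 1"

definition herm :: "complex ^ 'n \<Rightarrow> complex ^ 'n \<Rightarrow> complex" where
  "herm v p = (\<Sum>j\<in>UNIV. v $ j * cnj (p $ j))"

text \<open>The library's \<open>frechet_derivative\<close> is only real-linear; holomorphy on an open set asks
  in addition that it be complex-linear, where \<open>*s\<close> is multiplication by complex scalars.\<close>

definition holomorphic_map_on :: "(complex ^ 'n \<Rightarrow> complex ^ 'm) \<Rightarrow> (complex ^ 'n) set \<Rightarrow> bool" where
  "holomorphic_map_on F D \<longleftrightarrow>
     (\<forall>z\<in>D. F differentiable (at z) \<and>
        (\<forall>c v. frechet_derivative F (at z) (c *s v) = c *s frechet_derivative F (at z) v))"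

definition biholomorphism :: 
    "(complex ^ 'n \<Rightarrow> complex ^ 'm) \<Rightarrow> (complex ^ 'n) set \<Rightarrow> (complex ^ 'm) set \<Rightarrow> bool" where
  "biholomorphism F D E \<longleftrightarrow>
     holomorphic_map_on F D \<and> bij_betw F D E \<and> holomorphic_map_on (inv_into D F) E"

definition holomorphic_disc :: "(complex \<Rightarrow> complex ^ 'n) \<Rightarrow> (complex ^ 'n) set \<Rightarrow> bool" where
  "holomorphic_disc f D \<longleftrightarrow>
     f ` ball 0 1 \<subseteq> D \<and> (\<forall>j. (\<lambda>\<zeta>. f \<zeta> $ j) holomorphic_on ball 0 1)"

definition kobayashi :: "(complex ^ 'n) set \<Rightarrow> complex ^ 'n \<Rightarrow> complex ^ 'n \<Rightarrow> real" where
  "kobayashi D z v =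
     Inf {cmod \<xi> | \<xi>. \<exists>f. holomorphic_disc f D \<and> f 0 = z \<and>
                          \<xi> *s (\<chi> j. deriv (\<lambda>\<zeta>. f \<zeta> $ j) 0) = v}"

definition boundary_dist :: "(complex ^ 'n) set \<Rightarrow> complex ^ 'n \<Rightarrow> real" where
  "boundary_dist D z = Inf {norm (z - w) | w. w \<notin> D}"

definition complex_tangent :: "complex ^ 'n \<Rightarrow> (complex ^ 'n) set" where
  "complex_tangent p = {v. herm v p = 0}"

definition tangent_proj :: "complex ^ 'n \<Rightarrow> complex ^ 'n \<Rightarrow> complex ^ 'n" where
  "tangent_proj p v =
     (THE w. w \<in> complex_tangent p \<and> (\<forall>u\<in>complex_tangent p. herm (v - w) u = 0))"

text \<open>Meaningful for \<open>z \<noteq> 0\<close> only: at the origin every boundary point is closest.\<close>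

definition boundary_proj :: "complex ^ 'n \<Rightarrow> complex ^ 'n" where
  "boundary_proj z = closest_point (frontier unit_ball) z"

definition nontang_region :: "complex ^ 'n \<Rightarrow> real \<Rightarrow> (complex ^ 'n) set" where
  "nontang_region p M = {z \<in> unit_ball. norm (z - p) \<le> M * boundary_dist unit_ball z}"

definition nontang_tendsto :: "(nat \<Rightarrow> complex ^ 'n) \<Rightarrow> complex ^ 'n \<Rightarrow> bool" where
  "nontang_tendsto z p \<longleftrightarrow> z \<longlonglongrightarrow> p \<and> (\<exists>M>1. \<forall>k. z k \<in> nontang_region p M)"

text \<open>Accumulation points of a sequence, not limit points of its range: a value taken infinitely
  often counts.\<close>

definition accumulation_point :: "(nat \<Rightarrow> 'a::topological_space) \<Rightarrow> 'a \<Rightarrow> bool" where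
  "accumulation_point x w \<longleftrightarrow> (\<exists>r. strict_mono r \<and> (x \<circ> r) \<longlonglongrightarrow> w)"

definition complex_line :: "complex ^ 'n \<Rightarrow> complex ^ 'n \<Rightarrow> (complex ^ 'n) set" where
  "complex_line v p = {c *s v + p | c. True}"

end

theory Submission imports Defs begin

text \<open>For a disc \<open>f\<close> in the ball with \<open>f 0 = 0\<close> and \<open>|f' 0| < 1\<close>, applying Schwarz--Pick to
  \<open>f \<zeta> / \<zeta>\<close> shows that the Kobayashi length of \<open>f'\<close> stays below the hyperbolic density by at
  least a multiple of \<open>1 - |\<zeta>|\<close>. Up to automorphisms of the ball, this can be applied with any
  point \<open>z\<close> as the centre of the slice through \<open>z\<close> and \<open>e\<^sub>1\<close>, so the
  asymptotics of (b) force \<open>F\<close> to be isometric from \<open>z\<close> along that slice.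
  If \<open>F 0 = 0\<close>, then \<open>F (t e\<^sub>1) = t u\<close> for a unit vector \<open>u\<close>, and letting the
  second point of the slice tend to \<open>e\<^sub>1\<close> bounds
  \<open>(1 - \<langle>z, e\<^sub>1\<rangle>) / (1 - \<langle>F z, u\<rangle>)\<close> by \<open>1\<close>, its value at \<open>0\<close>. By the maximum principle it is
  constant, which gives \<open>|F z| = |z|\<close>, so \<open>F\<close> is unitary. Conversely, an automorphism is a
  ball involution composed with a unitary map: it preserves the Kobayashi metric and has bounded
  derivative.\<close>

text \<open>The order o(delta) in (b) is exactly what the argument can detect. Along the slice with
  a fixed centre z, for real zeta near 1, the quantities 1 - |zeta|, the distance to e and the
  distance to the sphere are comparable, and the derivative of the slice disc is a bounded multiple
  of one unit vector. A Schwarz-Pick loss of a fixed multiple of 1 - |zeta| would therefore be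
  visible in (b). The direction e - z is never complex tangent at e, so every z of the ball can
  serve as a centre. The obstacle is that this yields an isometry from the centre only, and along a
  single slice, while different slices have only the boundary point e in common. They are linked by
  showing that the images of all slices end at the same point u. In the limit the equality of
  pseudohyperbolic distances, weakened by the Schwarz lemma at 0, becomes a one-sided Julia
  inequality. One side is enough, since the holomorphic quotient which it bounds already attains the
  bound at 0.\<close>

unbundle no fps_syntax

section \<open>The Hermitian product\<close>

lemma herm_add_left: "herm (u + v) p = herm u p + herm v p"
  by (simp add: herm_def sum.distrib algebra_simps)

lemma herm_scale_left: "herm (c *s v) p = c * herm v p"
  by (simp add: herm_def sum_distrib_left algebra_simps)

lemma cnj_herm: "cnj (herm v p) = herm p v"
  by (simp add: herm_def mult.commute)

lemma herm_add_right: "herm p (u + v) = herm p u + herm p v"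
  by (simp add: herm_def sum.distrib algebra_simps)

lemma herm_scale_right: "herm p (c *s v) = cnj c * herm p v"
  by (simp add: herm_def sum_distrib_left algebra_simps)

lemma herm_diff_left: "herm (u - v) p = herm u p - herm v p"
  by (simp add: herm_def sum_subtractf algebra_simps)

lemma herm_diff_right: "herm p (u - v) = herm p u - herm p v"
  by (simp add: herm_def sum_subtractf algebra_simps)

lemma herm_zero [simp]: "herm 0 p = 0" "herm p 0 = 0"
  by (simp_all add: herm_def)

lemma herm_minus [simp]: "herm (- u) p = - herm u p" "herm p (- u) = - herm p u"
  by (simp_all add: herm_def sum_negf)

lemmas herm_simps = herm_add_left herm_scale_left herm_add_right herm_scale_right
  herm_diff_left herm_diff_right

lemma herm_axis: "herm v (axis j 1) = v $ j"
  by (simp add: herm_def axis_def if_distrib cong: if_cong)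

lemma inner_eq_Re_herm: "v \<bullet> w = Re (herm v w)"
  by (simp add: herm_def inner_vec_def inner_complex_def)

lemma herm_self: "herm v v = complex_of_real ((norm v)\<^sup>2)"
proof (rule complex_eqI)
  show "Re (herm v v) = Re (complex_of_real ((norm v)\<^sup>2))"
    by (simp add: power2_norm_eq_inner inner_eq_Re_herm)
  have "cnj (herm v v) = herm v v" by (rule cnj_herm)
  then show "Im (herm v v) = Im (complex_of_real ((norm v)\<^sup>2))"
    by (metis Im_complex_of_real Reals_cnj_iff complex_is_Real_iff)
qed

lemma norm_power2_Re_herm: "(norm v)\<^sup>2 = Re (herm v v)"
  by (simp add: herm_self)

lemma norm_vec_scale: "norm (c *s v) = cmod c * norm (v :: complex ^ 'n)"
proof -
  have "complex_of_real ((norm (c *s v))\<^sup>2) = complex_of_real ((cmod c * norm v)\<^sup>2)"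
    unfolding herm_self[symmetric] herm_simps
    by (simp add: herm_self power_mult_distrib complex_norm_square mult.assoc flip: of_real_power)
  then show ?thesis
    by (simp only: of_real_eq_iff power2_eq_iff_nonneg norm_ge_zero mult_nonneg_nonneg)
qed

lemma norm_scale_sgn: "complex_of_real (norm v) *s sgn v = (v :: complex ^ 'n)"
proof (cases "v = 0")
  case False
  have "complex_of_real (norm v) *s sgn v = norm v *\<^sub>R sgn v"
    by (simp add: vec_eq_iff scaleR_conv_of_real[where 'a=complex])
  with False show ?thesis by (simp add: sgn_div_norm)
qed simp

lemma herm_Cauchy_Schwarz: "cmod (herm v w) \<le> norm v * norm w"
proof (cases "herm v w = 0")
  case False
  let ?c = "herm v w"
  have "(cmod ?c)\<^sup>2 = (cnj ?c *s v) \<bullet> w"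
    unfolding cmod_power2 by (simp add: inner_eq_Re_herm herm_simps power2_eq_square)
  also have "\<dots> \<le> norm (cnj ?c *s v) * norm w"
    by (rule norm_cauchy_schwarz)
  also have "\<dots> = cmod ?c * (norm v * norm w)"
    by (simp add: norm_vec_scale)
  finally show ?thesis
    using False by (simp add: power2_eq_square)
qed simp

lemma norm_diff_scale_power2:
  "(norm (x *s u - y *s v))\<^sup>2 =
     (cmod x * norm u)\<^sup>2 - 2 * Re (x * cnj y * herm u v) + (cmod y * norm v)\<^sup>2"
proof -
  have "cnj x * y * herm v u = cnj (x * cnj y * herm u v)"
    by (simp add: cnj_herm)
  then have "Re (cnj x * (y * herm v u)) = Re (x * cnj y * herm u v)"
    by (metis complex_cnj(1) complex.sel(1) mult.assoc complex_cnj complex_surj)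
  moreover have "(norm (x *s u))\<^sup>2 = Re (herm (x *s u) (x *s u))" "(norm (y *s v))\<^sup>2 = Re (herm (y *s v) (y *s v))"
    by (simp_all add: norm_power2_Re_herm)
  ultimately show ?thesis
    unfolding norm_power2_Re_herm norm_vec_scale[symmetric] herm_diff_left herm_diff_right
    by (simp add: herm_simps algebra_simps)
qed

lemma bounded_bilinear_vec_scale: "bounded_bilinear ((*s) :: complex \<Rightarrow> complex ^ 'n \<Rightarrow> complex ^ 'n)"
proof
  show "\<exists>K. \<forall>(a::complex) (b::complex ^ 'n). norm (a *s b) \<le> norm a * norm b * K"
    by (intro exI[of _ 1]) (simp add: norm_vec_scale)
qed (simp_all add: vec_eq_iff algebra_simps)

lemmas has_derivative_vec_scale =
  bounded_bilinear.FDERIV[OF bounded_bilinear_vec_scale]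

lemma bounded_linear_herm_left: "bounded_linear (\<lambda>v. herm v p)"
proof
  show "\<exists>K. \<forall>x. norm (herm x p) \<le> norm x * K"
    using herm_Cauchy_Schwarz by (intro exI[of _ "norm p"]) auto
  show "herm (r *\<^sub>R b) p = r *\<^sub>R herm b p" for r b
    by (simp add: herm_def scaleR_sum_right)
qed (simp add: herm_simps)

lemmas tendsto_herm_left [tendsto_intros] = bounded_linear.tendsto[OF bounded_linear_herm_left]

section \<open>Involutive automorphisms of the ball\<close>

definition mob_scale :: "complex ^ 'n \<Rightarrow> complex" where
  "mob_scale a = complex_of_real (sqrt (1 - (norm a)\<^sup>2))"

text \<open>The involution of the ball exchanging \<open>0\<close> and \<open>a\<close>, usually written as
  \<open>(a - P\<^sub>a z - s Q\<^sub>a z) / (1 - \<langle>z, a\<rangle>)\<close> with \<open>P\<^sub>a\<close> the projection to the line of \<open>a\<close> and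
  \<open>s = \<surd>(1 - |a|\<^sup>2)\<close>.  Since \<open>(1 - s) / |a|\<^sup>2 = 1 / (1 + s)\<close>, the form below needs no case
  distinction at \<open>a = 0\<close>.\<close>

definition mob :: "complex ^ 'n \<Rightarrow> complex ^ 'n \<Rightarrow> complex ^ 'n" where
  "mob a z = inverse (1 - herm z a) *s
     ((1 - herm z a / (1 + mob_scale a)) *s a - mob_scale a *s z)"

lemma mob_scale_props:
  assumes "norm a < 1"
  shows "mob_scale a \<noteq> 0" "1 + mob_scale a \<noteq> 0" "cnj (mob_scale a) = mob_scale a"
    "(mob_scale a)\<^sup>2 = complex_of_real (1 - (norm a)\<^sup>2)" "herm a a = 1 - (mob_scale a)\<^sup>2"
    "0 < Re (mob_scale a)" "Im (mob_scale a) = 0" "cmod (mob_scale a) = Re (mob_scale a)"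
    "(Re (mob_scale a))\<^sup>2 = 1 - (norm a)\<^sup>2"
proof -
  have "(norm a)\<^sup>2 < 1" using assms by (simp add: power_less_one_iff)
  then have *: "0 < sqrt (1 - (norm a)\<^sup>2)" "(sqrt (1 - (norm a)\<^sup>2))\<^sup>2 = 1 - (norm a)\<^sup>2" by simp_all
  then show "mob_scale a \<noteq> 0" by (simp add: mob_scale_def)
  show "1 + mob_scale a \<noteq> 0" using *(1) by (simp add: mob_scale_def complex_eq_iff add_eq_0_iff del: real_sqrt_gt_0_iff)
  show 4: "(mob_scale a)\<^sup>2 = complex_of_real (1 - (norm a)\<^sup>2)"
    unfolding mob_scale_def of_real_power[symmetric] * ..
  show "herm a a = 1 - (mob_scale a)\<^sup>2" unfolding 4 by (simp add: herm_self)
  show "cnj (mob_scale a) = mob_scale a" "0 < Re (mob_scale a)" "Im (mob_scale a) = 0"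
    "cmod (mob_scale a) = Re (mob_scale a)" "(Re (mob_scale a))\<^sup>2 = 1 - (norm a)\<^sup>2"
    using * by (simp_all add: mob_scale_def)
qed

lemma one_minus_herm_nonzero:
  assumes "norm a < 1" "norm z \<le> 1"
  shows "1 - norm a \<le> cmod (1 - herm z a)" "1 - herm z a \<noteq> 0"
proof -
  have "cmod (herm z a) \<le> norm z * norm a" by (rule herm_Cauchy_Schwarz)
  also have "\<dots> \<le> norm a" using assms by (simp add: mult_left_le_one_le)
  finally have "cmod (herm z a) \<le> norm a" .
  with norm_triangle_ineq2[of 1 "herm z a"] show "1 - norm a \<le> cmod (1 - herm z a)"
    by simp
  with assms show "1 - herm z a \<noteq> 0" by auto
qed

text \<open>\<open>norm (mob a z)\<close> is the pseudohyperbolic distance of the ball, and the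
  later estimates read it off from this identity. Asking only for a nonzero denominator keeps points
  of the unit sphere in scope.\<close>

lemma one_minus_norm_mob:
  assumes a: "norm a < 1" and z: "1 - herm z a \<noteq> 0"
  shows "1 - (norm (mob a z))\<^sup>2 =
    (1 - (norm a)\<^sup>2) * (1 - (norm z)\<^sup>2) / (cmod (1 - herm z a))\<^sup>2"
proof -
  define s where "s = Re (mob_scale a)"
  have s: "mob_scale a = complex_of_real s" "s > 0" "(norm a)\<^sup>2 = 1 - s\<^sup>2"
    using mob_scale_props[OF a] by (auto simp: s_def complex_eq_iff)
  \<comment> \<open>In terms of \<open>k\<close> the quotient by 1 + s disappears, and the claim
    becomes a polynomial identity in s, k, its conjugate and |z|^2.\<close>
  define k where "k = herm z a / (1 + mob_scale a)"
  have k: "herm z a = (1 + complex_of_real s) * k"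
    using mob_scale_props(2)[OF a] by (simp add: k_def s(1))
  have "(norm ((1 - k) *s a - mob_scale a *s z))\<^sup>2 =
      (cmod (1 - k))\<^sup>2 * (1 - s\<^sup>2) - 2 * Re ((1 - k) * s * herm a z) + s\<^sup>2 * (norm z)\<^sup>2"
    unfolding norm_diff_scale_power2 power_mult_distrib s by simp
  also have "herm a z = (1 + complex_of_real s) * cnj k"
    using k by (metis cnj_herm complex_cnj_add complex_cnj_complex_of_real complex_cnj_mult complex_cnj_one)
  also have "(cmod (1 - k))\<^sup>2 * (1 - s\<^sup>2) - 2 * Re ((1 - k) * s * ((1 + complex_of_real s) * cnj k)) +
       s\<^sup>2 * (norm z)\<^sup>2 = (cmod (1 - herm z a))\<^sup>2 - s\<^sup>2 * (1 - (norm z)\<^sup>2)"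
    unfolding k cmod_power2 by (simp add: algebra_simps power2_eq_square)
  finally have N: "(norm ((1 - k) *s a - mob_scale a *s z))\<^sup>2 =
    (cmod (1 - herm z a))\<^sup>2 - s\<^sup>2 * (1 - (norm z)\<^sup>2)" .
  have "(norm (mob a z))\<^sup>2 = ((cmod (1 - herm z a))\<^sup>2 - s\<^sup>2 * (1 - (norm z)\<^sup>2)) / (cmod (1 - herm z a))\<^sup>2"
    unfolding mob_def norm_vec_scale power_mult_distrib k_def[symmetric] N norm_inverse power_inverse
    by (simp add: divide_inverse)
  then show ?thesis using z unfolding s(3) by (simp add: field_simps)
qed

lemma norm_mob_less_1:
  assumes "norm a < 1" "norm z < 1"
  shows "norm (mob a z) < 1"
proof -
  have "0 < 1 - (norm (mob a z))\<^sup>2"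
    using assms one_minus_herm_nonzero[of a z]
    by (subst one_minus_norm_mob) (auto simp: power_less_one_iff)
  then show ?thesis by (simp add: power_less_one_iff)
qed

lemma norm_mob_eq_1:
  assumes "norm a < 1" "norm z = 1"
  shows "norm (mob a z) = 1"
proof -
  have "1 - (norm (mob a z))\<^sup>2 = 0"
    using assms one_minus_herm_nonzero[of a z] by (subst one_minus_norm_mob) auto
  then show ?thesis by (simp add: power2_eq_1_iff) (smt (verit) norm_ge_zero)
qed

text \<open>This is the denominator of the outer map in \<open>mob_mob\<close>.\<close>

lemma one_minus_herm_mob:
  assumes a: "norm a < 1" and z: "1 - herm z a \<noteq> 0"
  shows "1 - herm (mob a z) a = (mob_scale a)\<^sup>2 / (1 - herm z a)"
proof -
  define s where "s = mob_scale a"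
  have s: "1 + s \<noteq> 0" "herm a a = 1 - s\<^sup>2" using mob_scale_props[OF a] by (auto simp: s_def)
  define k where "k = herm z a / (1 + s)"
  have k: "herm z a = (1 + s) * k" using s by (simp add: k_def)
  have "herm (mob a z) a = ((1 - k) * (1 - s\<^sup>2) - s * herm z a) / (1 - herm z a)"
    unfolding mob_def s_def[symmetric] k_def[symmetric] herm_simps s
    by (simp add: divide_inverse)
  then show ?thesis
    using z unfolding s_def[symmetric] k by (simp add: field_simps) (simp add: algebra_simps power2_eq_square)
qed

lemma mob_mob:
  assumes a: "norm a < 1" and z: "norm z \<le> 1"
  shows "mob a (mob a z) = z"
proof -
  define s where "s = mob_scale a"
  define D where "D = 1 - herm z a"
  have D: "D \<noteq> 0" using one_minus_herm_nonzero[OF assms] by (simp add: D_def)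
  have s: "s \<noteq> 0" "1 + s \<noteq> 0" using mob_scale_props[OF a] by (auto simp: s_def)
  have h: "1 - herm (mob a z) a = s\<^sup>2 / D" "herm (mob a z) a = 1 - s\<^sup>2 / D"
    using one_minus_herm_mob[OF a] D unfolding s_def D_def by (auto simp: algebra_simps)
  have hz: "herm z a = 1 - D" by (simp add: D_def)
  have m: "mob a z $ j = ((1 - (1 - D) / (1 + s)) * (a $ j) - s * (z $ j)) / D" for j
    by (simp add: mob_def s_def[symmetric] hz divide_inverse algebra_simps)
  show ?thesis
    unfolding vec_eq_iff
  proof
    fix j
    have "mob a (mob a z) $ j =
        inverse (s\<^sup>2 / D) * ((1 - (1 - s\<^sup>2 / D) / (1 + s)) * (a $ j) - s * (mob a z $ j))"
      unfolding mob_def[of a "mob a z"] s_def[symmetric] h by (simp add: algebra_simps)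
    also have "\<dots> = z $ j"
      unfolding m using D s by (simp add: divide_simps) (simp add: algebra_simps power2_eq_square)
    finally show "mob a (mob a z) $ j = z $ j" .
  qed
qed

lemma mob_0 [simp]: "mob a 0 = a"
  by (simp add: mob_def)

lemma mob_self [simp]: "norm a < 1 \<Longrightarrow> mob a a = 0"
  using mob_mob[of a 0] by simp

lemma mob_zero_left: "mob 0 z = - z"
  by (simp add: mob_def mob_scale_def)

text \<open>The quotient rule, with the squared denominator avoided by reusing the value
  \<open>mob a z\<close>. At z = a that value is 0, so the last term drops out where the metric is
  computed.\<close>

definition dmob :: "complex ^ 'n \<Rightarrow> complex ^ 'n \<Rightarrow> complex ^ 'n \<Rightarrow> complex ^ 'n" where
  "dmob a z v = inverse (1 - herm z a) *s
     (- (herm v a / (1 + mob_scale a)) *s a - mob_scale a *s v + herm v a *s mob a z)"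

lemma mob_has_derivative:
  assumes "1 - herm z a \<noteq> 0"
  shows "(mob a has_derivative dmob a z) (at z)"
proof -
  define N where "N = (\<lambda>z. (1 - herm z a * inverse (1 + mob_scale a)) *s a - mob_scale a *s z)"
  have h: "((\<lambda>z. herm z a) has_derivative (\<lambda>v. herm v a)) (at z)"
    by (rule bounded_linear.has_derivative[OF bounded_linear_herm_left has_derivative_ident])
  have "((\<lambda>z. inverse (1 - herm z a)) has_derivative
      (\<lambda>v. - (inverse (1 - herm z a) * (0 - herm v a) * inverse (1 - herm z a)))) (at z)"
    using assms by (intro Deriv.has_derivative_inverse has_derivative_diff has_derivative_const h)
  moreover have "(N has_derivative (\<lambda>v. (0 - herm v a * inverse (1 + mob_scale a)) *s a - mob_scale a *s v)) (at z)"
    unfolding N_def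
    by (intro has_derivative_diff has_derivative_const has_derivative_mult_left h has_derivative_ident
        bounded_linear.has_derivative[OF bounded_bilinear.bounded_linear_left[OF bounded_bilinear_vec_scale]]
        bounded_linear.has_derivative[OF bounded_bilinear.bounded_linear_right[OF bounded_bilinear_vec_scale]])
  ultimately have "((\<lambda>z. inverse (1 - herm z a) *s N z) has_derivative
     (\<lambda>v. inverse (1 - herm z a) *s ((0 - herm v a * inverse (1 + mob_scale a)) *s a - mob_scale a *s v)
       + (- (inverse (1 - herm z a) * (0 - herm v a) * inverse (1 - herm z a))) *s N z)) (at z)"
    by (rule has_derivative_vec_scale)
  moreover have "(\<lambda>z. inverse (1 - herm z a) *s N z) = mob a"
    by (simp add: mob_def N_def divide_inverse fun_eq_iff)
  moreover have "(\<lambda>v. inverse (1 - herm z a) *s ((0 - herm v a * inverse (1 + mob_scale a)) *s a - mob_scale a *s v)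
       + (- (inverse (1 - herm z a) * (0 - herm v a) * inverse (1 - herm z a))) *s N z) = dmob a z"
    by (simp add: dmob_def mob_def N_def divide_inverse fun_eq_iff vec_eq_iff algebra_simps)
  ultimately show ?thesis by simp
qed

lemma dmob_scale: "dmob a z (c *s v) = c *s dmob a z v"
  by (simp add: dmob_def vec_eq_iff herm_simps algebra_simps divide_inverse)

text \<open>Up to a constant the right side is the squared Bergman length of v at a. Since
  \<open>mob a\<close> carries a to 0, where the Kobayashi metric is the norm, this makes the metric
  of the ball explicit.\<close>

lemma norm_dmob_self:
  assumes a: "norm a < 1"
  shows "(norm (dmob a a v))\<^sup>2 =
    ((1 - (norm a)\<^sup>2) * (norm v)\<^sup>2 + (cmod (herm v a))\<^sup>2) / (1 - (norm a)\<^sup>2)\<^sup>2"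
proof -
  define s where "s = Re (mob_scale a)"
  have s: "mob_scale a = complex_of_real s" "s > 0" "(norm a)\<^sup>2 = 1 - s\<^sup>2"
    using mob_scale_props[OF a] by (auto simp: s_def complex_eq_iff)
  define k where "k = herm v a / (1 + mob_scale a)"
  have k: "herm v a = (1 + complex_of_real s) * k"
    using mob_scale_props(2)[OF a] by (simp add: k_def s(1))
  have k': "herm a v = (1 + complex_of_real s) * cnj k"
    using k by (metis cnj_herm complex_cnj_add complex_cnj_complex_of_real complex_cnj_mult complex_cnj_one)
  have d: "dmob a a v = inverse (complex_of_real (s\<^sup>2)) *s ((- k) *s a - mob_scale a *s v)"
    by (simp add: dmob_def a k_def herm_self s del: vector_ssub_ldistrib)
  have "(norm ((- k) *s a - mob_scale a *s v))\<^sup>2 = s\<^sup>2 * (norm v)\<^sup>2 + (cmod (herm v a))\<^sup>2"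
    unfolding norm_diff_scale_power2 power_mult_distrib s k k' cmod_power2
    by (simp add: algebra_simps power2_eq_square)
  then show ?thesis
    unfolding d norm_vec_scale power_mult_distrib
    by (simp add: s norm_inverse norm_power power_inverse divide_inverse algebra_simps
        del: vector_ssub_ldistrib)
qed

section \<open>Holomorphic discs and the Schwarz lemma\<close>

definition vderiv :: "(complex \<Rightarrow> complex ^ 'n) \<Rightarrow> complex \<Rightarrow> complex ^ 'n" where
  "vderiv f \<zeta> = (\<chi> j. deriv (\<lambda>\<zeta>. f \<zeta> $ j) \<zeta>)"

text \<open>The bridge between the componentwise holomorphy of \<open>holomorphic_disc\<close> and
  the Frechet derivative, for which chain and product rules apply to the whole vector.\<close>

lemma has_derivative_vec_nth_iff:
  fixes f :: "complex \<Rightarrow> complex ^ 'n"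
  shows "(f has_derivative (\<lambda>h. h *s d)) (at \<zeta>) \<longleftrightarrow>
    (\<forall>j. ((\<lambda>\<zeta>. f \<zeta> $ j) has_field_derivative d $ j) (at \<zeta>))"
proof
  assume f: "(f has_derivative (\<lambda>h. h *s d)) (at \<zeta>)"
  show "\<forall>j. ((\<lambda>\<zeta>. f \<zeta> $ j) has_field_derivative d $ j) (at \<zeta>)"
  proof
    fix j
    show "((\<lambda>\<zeta>. f \<zeta> $ j) has_field_derivative d $ j) (at \<zeta>)"
      using bounded_linear.has_derivative[OF bounded_linear_vec_nth f, of j]
      by (simp add: has_field_derivative_def mult_commute_abs)
  qed
next
  assume f: "\<forall>j. ((\<lambda>\<zeta>. f \<zeta> $ j) has_field_derivative d $ j) (at \<zeta>)"
  have "((\<lambda>\<zeta>. \<Sum>j\<in>UNIV. f \<zeta> $ j *s axis j 1) has_derivative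
      (\<lambda>h. \<Sum>j\<in>UNIV. (h * d $ j) *s axis j 1)) (at \<zeta>)"
  proof (intro has_derivative_sum)
    fix j
    have "((\<lambda>\<zeta>. f \<zeta> $ j) has_derivative (\<lambda>h. h * d $ j)) (at \<zeta>)"
      using f by (simp add: has_field_derivative_def mult_commute_abs)
    from bounded_linear.has_derivative[OF bounded_bilinear.bounded_linear_left[OF bounded_bilinear_vec_scale] this]
    show "((\<lambda>\<zeta>. f \<zeta> $ j *s axis j (1::complex)) has_derivative (\<lambda>h. (h * d $ j) *s axis j 1)) (at \<zeta>)" .
  qed
  moreover have "(\<lambda>\<zeta>. \<Sum>j\<in>UNIV. f \<zeta> $ j *s axis j 1) = f"
    by (simp add: fun_eq_iff vec_eq_iff axis_def if_distrib cong: if_cong)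
  moreover have "(\<lambda>h. \<Sum>j\<in>UNIV. (h * d $ j) *s axis j 1) = (\<lambda>h. h *s d)"
    by (simp add: fun_eq_iff vec_eq_iff axis_def if_distrib cong: if_cong)
  ultimately show "(f has_derivative (\<lambda>h. h *s d)) (at \<zeta>)" by simp
qed

lemma vderiv_eqI: "(f has_derivative (\<lambda>h. h *s d)) (at \<zeta>) \<Longrightarrow> vderiv f \<zeta> = d"
  unfolding has_derivative_vec_nth_iff vderiv_def by (simp add: vec_eq_iff DERIV_imp_deriv)

lemma holomorphic_discD:
  assumes "holomorphic_disc f D" "norm \<zeta> < 1"
  shows "f \<zeta> \<in> D" "(f has_derivative (\<lambda>h. h *s vderiv f \<zeta>)) (at \<zeta>)"
proof -
  show "f \<zeta> \<in> D" using assms by (auto simp: holomorphic_disc_def)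
  show "(f has_derivative (\<lambda>h. h *s vderiv f \<zeta>)) (at \<zeta>)"
    unfolding has_derivative_vec_nth_iff vderiv_def
    using assms by (auto simp: holomorphic_disc_def intro!: holomorphic_derivI[of _ "ball 0 1"])
qed

lemma holomorphic_discI:
  assumes "\<And>\<zeta>. norm \<zeta> < 1 \<Longrightarrow> f \<zeta> \<in> D"
    "\<And>\<zeta>. norm \<zeta> < 1 \<Longrightarrow> (f has_derivative (\<lambda>h. h *s d \<zeta>)) (at \<zeta>)"
  shows "holomorphic_disc f D"
  using assms unfolding holomorphic_disc_def has_derivative_vec_nth_iff
  by (simp add: image_subset_iff holomorphic_on_open) (metis mem_ball_0)

section \<open>Holomorphic maps and discs under composition\<close>

lemma holomorphic_mapD:
  assumes "holomorphic_map_on F D" "z \<in> D"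
  shows "(F has_derivative frechet_derivative F (at z)) (at z)"
    "frechet_derivative F (at z) (c *s v) = c *s frechet_derivative F (at z) v"
  using assms by (auto simp: holomorphic_map_on_def frechet_derivative_works)

lemma holomorphic_mapI:
  assumes "\<And>z. z \<in> D \<Longrightarrow> (F has_derivative F' z) (at z)"
    "\<And>z c v. z \<in> D \<Longrightarrow> F' z (c *s v) = c *s F' z v"
  shows "holomorphic_map_on F D"
  unfolding holomorphic_map_on_def
proof (intro ballI conjI allI)
  fix z c v assume z: "z \<in> D"
  have "F' z = frechet_derivative F (at z)"
    by (rule frechet_derivative_at[OF assms(1)[OF z]])
  with assms(2)[OF z] show "frechet_derivative F (at z) (c *s v) = c *s frechet_derivative F (at z) v"
    by metis
qed (use assms in \<open>auto simp: differentiable_def\<close>)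

lemma holomorphic_map_comp:
  assumes F: "holomorphic_map_on F D" and G: "holomorphic_map_on G E" and im: "F ` D \<subseteq> E"
  shows "holomorphic_map_on (\<lambda>z. G (F z)) D"
    "z \<in> D \<Longrightarrow> frechet_derivative (\<lambda>z. G (F z)) (at z) v =
       frechet_derivative G (at (F z)) (frechet_derivative F (at z) v)"
proof -
  have d: "((\<lambda>z. G (F z)) has_derivative
      (\<lambda>v. frechet_derivative G (at (F z)) (frechet_derivative F (at z) v))) (at z)"
    if "z \<in> D" for z
    using that im holomorphic_mapD(1)[OF F that] holomorphic_mapD(1)[OF G, of "F z"]
    by (auto intro: has_derivative_compose)
  show "holomorphic_map_on (\<lambda>z. G (F z)) D"
    by (rule holomorphic_mapI, erule d) (use im holomorphic_mapD(2)[OF F] holomorphic_mapD(2)[OF G] in auto)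
  show "z \<in> D \<Longrightarrow> frechet_derivative (\<lambda>z. G (F z)) (at z) v =
       frechet_derivative G (at (F z)) (frechet_derivative F (at z) v)"
    using frechet_derivative_at[OF d, of z] by metis
qed

lemma holomorphic_map_transform:
  assumes F: "holomorphic_map_on F D" and D: "open D" and eq: "\<And>z. z \<in> D \<Longrightarrow> G z = F z"
  shows "holomorphic_map_on G D"
    "z \<in> D \<Longrightarrow> frechet_derivative G (at z) = frechet_derivative F (at z)"
proof -
  have d: "(G has_derivative frechet_derivative F (at z)) (at z)" if "z \<in> D" for z
    by (rule has_derivative_transform_within_open[OF holomorphic_mapD(1)[OF F that] D that])
      (simp add: eq)
  show "holomorphic_map_on G D"
    by (rule holomorphic_mapI, erule d) (use holomorphic_mapD(2)[OF F] in auto)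
  show "z \<in> D \<Longrightarrow> frechet_derivative G (at z) = frechet_derivative F (at z)"
    using frechet_derivative_at[OF d, of z] by metis
qed

lemma holomorphic_disc_comp:
  assumes F: "holomorphic_map_on F D" and f: "holomorphic_disc f D" and im: "F ` D \<subseteq> E"
  shows "holomorphic_disc (\<lambda>\<zeta>. F (f \<zeta>)) E"
    "norm \<zeta> < 1 \<Longrightarrow> vderiv (\<lambda>\<zeta>. F (f \<zeta>)) \<zeta> = frechet_derivative F (at (f \<zeta>)) (vderiv f \<zeta>)"
proof -
  have d: "((\<lambda>\<zeta>. F (f \<zeta>)) has_derivative (\<lambda>h. h *s frechet_derivative F (at (f \<zeta>)) (vderiv f \<zeta>))) (at \<zeta>)"
    if "norm \<zeta> < 1" for \<zeta>
  proof -
    note * = holomorphic_discD[OF f that]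
    have "((\<lambda>\<zeta>. F (f \<zeta>)) has_derivative (\<lambda>h. frechet_derivative F (at (f \<zeta>)) (h *s vderiv f \<zeta>))) (at \<zeta>)"
      by (rule has_derivative_compose[OF *(2) holomorphic_mapD(1)[OF F *(1)]])
    then show ?thesis by (simp add: holomorphic_mapD(2)[OF F *(1)])
  qed
  show "holomorphic_disc (\<lambda>\<zeta>. F (f \<zeta>)) E"
    using im holomorphic_discD(1)[OF f] by (auto intro!: holomorphic_discI d)
  show "norm \<zeta> < 1 \<Longrightarrow> vderiv (\<lambda>\<zeta>. F (f \<zeta>)) \<zeta> = frechet_derivative F (at (f \<zeta>)) (vderiv f \<zeta>)"
    by (rule vderiv_eqI[OF d])
qed

lemma holomorphic_disc_reparam:
  assumes f: "holomorphic_disc f D" and m: "m holomorphic_on ball 0 1" "m ` ball 0 1 \<subseteq> ball 0 1"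
  shows "holomorphic_disc (\<lambda>\<zeta>. f (m \<zeta>)) D"
    "norm \<zeta> < 1 \<Longrightarrow> vderiv (\<lambda>\<zeta>. f (m \<zeta>)) \<zeta> = deriv m \<zeta> *s vderiv f (m \<zeta>)"
proof -
  have d: "((\<lambda>\<zeta>. f (m \<zeta>)) has_derivative (\<lambda>h. h *s (deriv m \<zeta> *s vderiv f (m \<zeta>)))) (at \<zeta>)"
    if \<zeta>: "norm \<zeta> < 1" for \<zeta>
  proof -
    have "(m has_derivative (\<lambda>h. deriv m \<zeta> * h)) (at \<zeta>)"
      using holomorphic_derivI[OF m(1), of \<zeta>] \<zeta> by (simp add: has_field_derivative_def)
    moreover have "norm (m \<zeta>) < 1" using m(2) \<zeta> by (simp add: image_subset_iff)
    ultimately have "((\<lambda>\<zeta>. f (m \<zeta>)) has_derivative (\<lambda>h. (deriv m \<zeta> * h) *s vderiv f (m \<zeta>))) (at \<zeta>)"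
      by (intro has_derivative_compose[OF _ holomorphic_discD(2)[OF f]])
    then show ?thesis by (simp add: mult.commute)
  qed
  show "holomorphic_disc (\<lambda>\<zeta>. f (m \<zeta>)) D"
    using m(2) by (intro holomorphic_discI[OF _ d] holomorphic_discD(1)[OF f]) (auto simp: image_subset_iff)
  show "norm \<zeta> < 1 \<Longrightarrow> vderiv (\<lambda>\<zeta>. f (m \<zeta>)) \<zeta> = deriv m \<zeta> *s vderiv f (m \<zeta>)"
    by (rule vderiv_eqI[OF d])
qed

lemma holomorphic_disc_line:
  assumes "norm p \<le> 1"
  shows "holomorphic_disc (\<lambda>\<zeta>. \<zeta> *s p) unit_ball" "vderiv (\<lambda>\<zeta>. \<zeta> *s p) \<zeta> = p"
proof -
  have d: "((\<lambda>\<zeta>. \<zeta> *s p) has_derivative (\<lambda>h. h *s p)) (at \<zeta>)" for \<zeta>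
    by (rule bounded_linear_imp_has_derivative[OF bounded_bilinear.bounded_linear_left[OF bounded_bilinear_vec_scale]])
  show "holomorphic_disc (\<lambda>\<zeta>. \<zeta> *s p) unit_ball"
    using assms by (intro holomorphic_discI[where d = "\<lambda>_. p"] d)
      (auto simp: norm_vec_scale intro: le_less_trans[OF mult_left_le])
  show "vderiv (\<lambda>\<zeta>. \<zeta> *s p) \<zeta> = p"
    by (rule vderiv_eqI[OF d])
qed

lemma holomorphic_herm_disc:
  assumes f: "holomorphic_disc f D"
  shows "(\<lambda>\<zeta>. herm (f \<zeta>) p) holomorphic_on ball 0 1"
    "norm \<zeta> < 1 \<Longrightarrow> deriv (\<lambda>\<zeta>. herm (f \<zeta>) p) \<zeta> = herm (vderiv f \<zeta>) p"
proof -
  have d: "((\<lambda>\<zeta>. herm (f \<zeta>) p) has_field_derivative herm (vderiv f \<zeta>) p) (at \<zeta>)"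
    if "norm \<zeta> < 1" for \<zeta>
    using bounded_linear.has_derivative[OF bounded_linear_herm_left holomorphic_discD(2)[OF f that], of p]
    by (simp add: has_field_derivative_def herm_simps mult_commute_abs)
  show "(\<lambda>\<zeta>. herm (f \<zeta>) p) holomorphic_on ball 0 1"
    using d by (simp add: holomorphic_on_open) (metis mem_ball_0)
  show "norm \<zeta> < 1 \<Longrightarrow> deriv (\<lambda>\<zeta>. herm (f \<zeta>) p) \<zeta> = herm (vderiv f \<zeta>) p"
    by (rule DERIV_imp_deriv[OF d])
qed

text \<open>The disc is tested against linear functionals; strict convexity of the norm then turns
  equality in the scalar lemma into linearity.\<close>

lemma Schwarz_disc:
  fixes f :: "complex \<Rightarrow> complex ^ 'n"
  assumes f: "holomorphic_disc f unit_ball" and f0: "f 0 = 0"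
  shows "norm \<zeta> < 1 \<Longrightarrow> norm (f \<zeta>) \<le> norm \<zeta>" "norm (vderiv f 0) \<le> 1"
    "(\<exists>\<zeta>. norm \<zeta> < 1 \<and> \<zeta> \<noteq> 0 \<and> norm (f \<zeta>) = norm \<zeta>) \<or> norm (vderiv f 0) = 1 \<Longrightarrow>
       norm (vderiv f 0) = 1 \<and> (\<forall>\<zeta>. norm \<zeta> < 1 \<longrightarrow> f \<zeta> = \<zeta> *s vderiv f 0)"
proof -
  have lt: "cmod (herm (f \<zeta>) p) < 1" if "norm \<zeta> < 1" "norm p = 1" for p \<zeta>
    using herm_Cauchy_Schwarz[of "f \<zeta>" p] holomorphic_discD(1)[OF f that(1)] that(2) by auto
  note S = Schwarz_Lemma[OF holomorphic_herm_disc(1)[OF f]]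
  \<comment> \<open>Testing against \<open>sgn v\<close> recovers the norm of v, so scalar bounds
    for all unit functionals bound the vector.\<close>
  have *: "cmod (herm v (sgn v)) = norm v" for v :: "complex ^ 'n"
  proof -
    have "sgn v = complex_of_real (inverse (norm v)) *s v"
      by (simp add: sgn_vec_def vec_eq_iff) (simp add: scaleR_conv_of_real)
    then show ?thesis
      by (cases "v = 0") (simp_all add: herm_simps herm_self norm_mult norm_inverse power2_eq_square)
  qed
  have d: "deriv (\<lambda>\<zeta>. herm (f \<zeta>) p) 0 = herm (vderiv f 0) p" for p
    by (rule holomorphic_herm_disc(2)[OF f]) simp
  have ns: "norm (sgn v) = 1" if "v \<noteq> 0" for v :: "complex ^ 'n" using that by (simp add: norm_sgn)
  show 1: "norm (f \<zeta>) \<le> norm \<zeta>" if "norm \<zeta> < 1" for \<zeta>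
  proof (cases "f \<zeta> = 0")
    case False
    show ?thesis
      using S(1)[of "sgn (f \<zeta>)" \<zeta>] that lt ns[OF False] f0 * by simp
  qed simp
  show 2: "norm (vderiv f 0) \<le> 1"
  proof (cases "vderiv f 0 = 0")
    case False
    show ?thesis
      using S(2)[of "sgn (vderiv f 0)" 0] lt ns[OF False] f0 * d by simp
  qed simp
  assume "(\<exists>\<zeta>. norm \<zeta> < 1 \<and> \<zeta> \<noteq> 0 \<and> norm (f \<zeta>) = norm \<zeta>) \<or> norm (vderiv f 0) = 1"
  then obtain p where p: "norm p = 1"
    "(\<exists>\<zeta>. norm \<zeta> < 1 \<and> \<zeta> \<noteq> 0 \<and> norm (herm (f \<zeta>) p) = norm \<zeta>) \<or> norm (herm (vderiv f 0) p) = 1"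
  proof
    assume "\<exists>\<zeta>. norm \<zeta> < 1 \<and> \<zeta> \<noteq> 0 \<and> norm (f \<zeta>) = norm \<zeta>"
    then obtain \<zeta> where "norm \<zeta> < 1" "\<zeta> \<noteq> 0" "norm (f \<zeta>) = norm \<zeta>" by blast
    then show thesis using that[of "sgn (f \<zeta>)"] ns[of "f \<zeta>"] * by fastforce
  next
    assume "norm (vderiv f 0) = 1"
    then show thesis using that[of "sgn (vderiv f 0)"] ns[of "vderiv f 0"] * by fastforce
  qed
  then obtain \<alpha> where \<alpha>: "\<And>\<zeta>. norm \<zeta> < 1 \<Longrightarrow> herm (f \<zeta>) p = \<alpha> * \<zeta>" "cmod \<alpha> = 1"
    using S(3)[of p 0] lt f0 d by auto
  have lin: "f \<zeta> = \<zeta> *s (\<alpha> *s p)" if \<zeta>: "norm \<zeta> < 1" for \<zeta>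
  proof -
    have "cnj (\<alpha> * \<zeta>) * (\<alpha> * \<zeta>) = complex_of_real ((cmod \<zeta>)\<^sup>2)"
      using complex_norm_square[of "\<alpha> * \<zeta>"] \<alpha>(2) by (simp add: norm_mult mult.commute)
    then have "Re (1 * cnj (\<alpha> * \<zeta>) * herm (f \<zeta>) p) = (cmod \<zeta>)\<^sup>2"
      by (simp only: \<alpha>(1)[OF \<zeta>] mult_1_left Re_complex_of_real)
    \<comment> \<open>The cross term is -2 |zeta|^2, because the pairing with p is known exactly. As
      |f| is at most |zeta|, the square of the distance to the linear disc is nonpositive.\<close>
    then have "(norm (1 *s f \<zeta> - (\<alpha> * \<zeta>) *s p))\<^sup>2 = (norm (f \<zeta>))\<^sup>2 - (cmod \<zeta>)\<^sup>2"
      unfolding norm_diff_scale_power2 using \<alpha>(2) p(1) by (simp add: norm_mult)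
    also have "\<dots> \<le> 0" using 1[OF \<zeta>] by simp
    finally show ?thesis by (simp add: mult.commute)
  qed
  have "vderiv f 0 = vderiv (\<lambda>\<zeta>. \<zeta> *s (\<alpha> *s p)) 0"
  proof (rule vderiv_eqI, rule has_derivative_transform_within_open[where s="ball 0 1"])
    show "((\<lambda>\<zeta>. \<zeta> *s (\<alpha> *s p)) has_derivative (\<lambda>h. h *s vderiv (\<lambda>\<zeta>. \<zeta> *s (\<alpha> *s p)) 0)) (at 0)"
      by (rule holomorphic_discD(2)[OF holomorphic_disc_line(1)]) (simp_all add: norm_vec_scale \<alpha> p del: vector_smult_assoc)
  qed (use lin in auto)
  also have "\<dots> = \<alpha> *s p"
    by (rule holomorphic_disc_line(2)) (simp add: norm_vec_scale \<alpha> p)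
  finally have "vderiv f 0 = \<alpha> *s p" .
  with lin show "norm (vderiv f 0) = 1 \<and> (\<forall>\<zeta>. norm \<zeta> < 1 \<longrightarrow> f \<zeta> = \<zeta> *s vderiv f 0)"
    by (simp add: norm_vec_scale \<alpha> p)
qed

section \<open>The Kobayashi metric of the ball\<close>

lemma mob_holomorphic:
  assumes a: "norm a < 1"
  shows "holomorphic_map_on (mob a) unit_ball" "mob a ` unit_ball \<subseteq> unit_ball"
    "norm z \<le> 1 \<Longrightarrow> frechet_derivative (mob a) (at z) = dmob a z"
proof -
  have d: "(mob a has_derivative dmob a z) (at z)" if "norm z \<le> 1" for z
    by (rule mob_has_derivative) (rule one_minus_herm_nonzero[OF a that])
  show "holomorphic_map_on (mob a) unit_ball"
    by (rule holomorphic_mapI[where F' = "dmob a"]) (auto intro: d simp: dmob_scale)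
  show "norm z \<le> 1 \<Longrightarrow> frechet_derivative (mob a) (at z) = dmob a z"
    by (metis d frechet_derivative_at)
  show "mob a ` unit_ball \<subseteq> unit_ball" using norm_mob_less_1[OF a] by auto
qed

lemma derivative_left_inverse:
  assumes F: "holomorphic_map_on F D" and G: "holomorphic_map_on G E" and im: "F ` D \<subseteq> E"
    and inv: "\<And>z. z \<in> D \<Longrightarrow> G (F z) = z" and D: "open D" "z \<in> D"
  shows "frechet_derivative G (at (F z)) (frechet_derivative F (at z) v) = v"
proof -
  have "((\<lambda>z. z) has_derivative frechet_derivative (\<lambda>z. G (F z)) (at z)) (at z)"
    by (rule has_derivative_transform_within_open[OF holomorphic_mapD(1)[OF holomorphic_map_comp(1)[OF F G im]]])
      (use D inv in auto)
  then have "frechet_derivative (\<lambda>z. G (F z)) (at z) = (\<lambda>v. v)"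
    using has_derivative_ident has_derivative_unique by blast
  then show ?thesis by (metis holomorphic_map_comp(2)[OF F G im D(2)])
qed

lemma dmob_dmob:
  assumes "norm a < 1" "norm z < 1"
  shows "dmob a (mob a z) (dmob a z v) = v"
  using derivative_left_inverse[OF mob_holomorphic(1,1,2), of a a z v] assms
    mob_holomorphic(3)[of a] mob_mob[of a] norm_mob_less_1[of a z]
  by (simp add: less_imp_le)

lemma kobayashi_le:
  assumes "holomorphic_disc f D" "f 0 = z" "\<xi> *s vderiv f 0 = v"
  shows "kobayashi D z v \<le> cmod \<xi>"
  unfolding kobayashi_def vderiv_def[symmetric]
  by (rule cInf_lower) (use assms in \<open>auto intro: bdd_belowI[of _ 0]\<close>)

text \<open>The involution \<open>mob z\<close> moves the base point to 0, where the Schwarz lemma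
  makes the straight disc extremal. Having an extremal disc, and not just the infimum, lets
  \<open>kobayashi_contraction\<close> push a single disc forward.\<close>

lemma kobayashi_ball_attained:
  assumes z: "norm z < 1"
  shows "kobayashi unit_ball z v = norm (dmob z z v)"
    "\<exists>f \<xi>. holomorphic_disc f unit_ball \<and> f 0 = z \<and> \<xi> *s vderiv f 0 = v \<and> cmod \<xi> = norm (dmob z z v)"
proof -
  define p where "p = sgn (dmob z z v)"
  define \<xi> where "\<xi> = complex_of_real (norm (dmob z z v))"
  \<comment> \<open>Not an equality: if the transported vector is 0, then p is 0 and the extremal
    disc is constant.\<close>
  have p: "norm p \<le> 1" by (simp add: p_def norm_sgn)
  have \<xi>p: "\<xi> *s p = dmob z z v"
    by (simp add: p_def \<xi>_def norm_scale_sgn)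
  note l = holomorphic_disc_line[OF p]
  note c = holomorphic_disc_comp[OF mob_holomorphic(1)[OF z] l(1) mob_holomorphic(2)[OF z]]
  have "vderiv (\<lambda>\<zeta>. mob z (\<zeta> *s p)) 0 = dmob z 0 p"
    using c(2)[of 0] l(2) mob_holomorphic(3)[OF z, of 0] by simp
  moreover have "dmob z 0 (dmob z z v) = v"
    using dmob_dmob[of z z] z by simp
  ultimately have v: "\<xi> *s vderiv (\<lambda>\<zeta>. mob z (\<zeta> *s p)) 0 = v"
    by (simp add: dmob_scale[symmetric] \<xi>p)
  show ex: "\<exists>f \<xi>. holomorphic_disc f unit_ball \<and> f 0 = z \<and> \<xi> *s vderiv f 0 = v \<and> cmod \<xi> = norm (dmob z z v)"
    by (rule exI[of _ "\<lambda>\<zeta>. mob z (\<zeta> *s p)"], rule exI[of _ \<xi>]) (use c(1) v in \<open>simp add: \<xi>_def\<close>)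
  show "kobayashi unit_ball z v = norm (dmob z z v)"
    unfolding kobayashi_def vderiv_def[symmetric]
  proof (rule cInf_eq_minimum)
    show "norm (dmob z z v) \<in> {cmod \<xi> |\<xi>. \<exists>f. holomorphic_disc f unit_ball \<and> f 0 = z \<and> \<xi> *s vderiv f 0 = v}"
      using ex by force
  next
    fix x assume "x \<in> {cmod \<xi> |\<xi>. \<exists>f. holomorphic_disc f unit_ball \<and> f 0 = z \<and> \<xi> *s vderiv f 0 = v}"
    then obtain f \<xi> where f: "x = cmod \<xi>" "holomorphic_disc f unit_ball" "f 0 = z" "\<xi> *s vderiv f 0 = v"
      by blast
    note c = holomorphic_disc_comp[OF mob_holomorphic(1)[OF z] f(2) mob_holomorphic(2)[OF z]]
    have "norm (dmob z z (vderiv f 0)) \<le> 1"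
      using Schwarz_disc(2)[OF c(1)] c(2)[of 0] z f(3) mob_holomorphic(3)[OF z, of z] by simp
    then have "cmod \<xi> * norm (dmob z z (vderiv f 0)) \<le> cmod \<xi>" by (simp add: mult_left_le)
    then show "norm (dmob z z v) \<le> x"
      by (simp add: f(1) f(4)[symmetric] dmob_scale norm_vec_scale)
  qed
qed

lemma kobayashi_ball:
  assumes "norm z < 1"
  shows "(kobayashi unit_ball z v)\<^sup>2 =
    ((1 - (norm z)\<^sup>2) * (norm v)\<^sup>2 + (cmod (herm v z))\<^sup>2) / (1 - (norm z)\<^sup>2)\<^sup>2"
    "0 \<le> kobayashi unit_ball z v"
    "kobayashi unit_ball z (c *s v) = cmod c * kobayashi unit_ball z v"
  by (simp_all add: kobayashi_ball_attained assms norm_dmob_self dmob_scale norm_vec_scale)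

lemma kobayashi_contraction:
  assumes F: "holomorphic_map_on F unit_ball" "F ` unit_ball \<subseteq> unit_ball" and z: "norm z < 1"
  shows "kobayashi unit_ball (F z) (frechet_derivative F (at z) v) \<le> kobayashi unit_ball z v"
proof -
  obtain f \<xi> where f: "holomorphic_disc f unit_ball" "f 0 = z" "\<xi> *s vderiv f 0 = v"
    "cmod \<xi> = kobayashi unit_ball z v"
    using kobayashi_ball_attained[OF z, of v] by auto
  note c = holomorphic_disc_comp[OF F(1) f(1) F(2)]
  have "\<xi> *s vderiv (\<lambda>\<zeta>. F (f \<zeta>)) 0 = frechet_derivative F (at z) v"
    using c(2)[of 0] f(2) holomorphic_mapD(2)[OF F(1), of z \<xi> "vderiv f 0"] z
    unfolding f(3)[symmetric] by simp
  from kobayashi_le[OF c(1) _ this, of "F z"] f show ?thesis by simp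
qed

lemma kobayashi_automorphism:
  assumes F: "holomorphic_map_on F unit_ball" "F ` unit_ball \<subseteq> unit_ball"
    and G: "holomorphic_map_on G unit_ball" "G ` unit_ball \<subseteq> unit_ball"
    and inv: "\<And>z. z \<in> unit_ball \<Longrightarrow> G (F z) = z" and z: "norm z < 1"
  shows "kobayashi unit_ball (F z) (frechet_derivative F (at z) v) = kobayashi unit_ball z v"
proof (rule antisym[OF kobayashi_contraction[OF F z]])
  have "norm (F z) < 1" using F(2) z by (auto simp: image_subset_iff)
  from kobayashi_contraction[OF G this, of "frechet_derivative F (at z) v"]
  show "kobayashi unit_ball z v \<le> kobayashi unit_ball (F z) (frechet_derivative F (at z) v)"
    using derivative_left_inverse[OF F(1) G(1) F(2) inv _, of z v] inv z by simp
qed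

lemma kobayashi_mob:
  assumes "norm a < 1" "norm z < 1"
  shows "kobayashi unit_ball (mob a z) (dmob a z v) = kobayashi unit_ball z v"
  using kobayashi_automorphism[OF mob_holomorphic(1,2,1,2), of a a z v] mob_mob[of a] assms
    mob_holomorphic(3)[of a z] by (simp add: less_imp_le)

text \<open>Schwarz-Pick for discs. The automorphism of the unit disk taking 0 to zeta has
  derivative 1 - |zeta|^2 at 0, so f precomposed with it competes in the infimum at
  \<open>f \<zeta>\<close>.\<close>

lemma kobayashi_disc:
  assumes f: "holomorphic_disc f D" and \<zeta>: "norm \<zeta> < 1"
  shows "kobayashi D (f \<zeta>) (vderiv f \<zeta>) \<le> 1 / (1 - (cmod \<zeta>)\<^sup>2)"
proof -
  define m where "m = Moebius_function 0 (- \<zeta>)"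
  have m: "m holomorphic_on ball 0 1" "m ` ball 0 1 \<subseteq> ball 0 1"
    using Moebius_function_holomorphic[of "- \<zeta>"] Moebius_function_norm_lt_1[of "- \<zeta>"] \<zeta>
    by (auto simp: m_def)
  have pos: "1 - (cmod \<zeta>)\<^sup>2 > 0" using \<zeta> by (simp add: power_less_one_iff)
  have m0: "m 0 = \<zeta>" by (simp add: m_def Moebius_function_of_zero)
  have "(m has_field_derivative 1 - \<zeta> * cnj \<zeta>) (at 0)"
    unfolding m_def Moebius_function_simple[abs_def]
    by (auto intro!: derivative_eq_intros simp: algebra_simps)
  then have dm: "deriv m 0 = complex_of_real (1 - (cmod \<zeta>)\<^sup>2)"
    using complex_norm_square[of \<zeta>] by (simp add: DERIV_imp_deriv)
  note r = holomorphic_disc_reparam[OF f m]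
  have "(1 / complex_of_real (1 - (cmod \<zeta>)\<^sup>2)) *s vderiv (\<lambda>\<zeta>. f (m \<zeta>)) 0 = vderiv f \<zeta>"
    using r(2)[of 0] pos unfolding dm m0 by (simp del: of_real_diff of_real_1)
  from kobayashi_le[OF r(1) _ this, of "f \<zeta>"] pos show ?thesis
    by (simp add: m0 norm_divide del: of_real_diff of_real_1)
qed

lemma Schwarz_ball:
  assumes H: "holomorphic_map_on H unit_ball" "H ` unit_ball \<subseteq> unit_ball" "H 0 = 0" and x: "norm x < 1"
  shows "norm (H x) \<le> norm x"
proof -
  have "x = complex_of_real (norm x) *s sgn x"
    by (simp add: norm_scale_sgn)
  moreover have "holomorphic_disc (\<lambda>\<zeta>. H (\<zeta> *s sgn x)) unit_ball"
    by (rule holomorphic_disc_comp(1)[OF H(1) holomorphic_disc_line(1) H(2)]) (simp add: norm_sgn)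
  note Schwarz_disc(1)[OF this, of "complex_of_real (norm x)"]
  ultimately show ?thesis using x H(3) by simp
qed

text \<open>Invariant form of the Schwarz lemma: the involutions at z and at F z move both base
  points to 0.\<close>

lemma mob_contraction:
  assumes F: "holomorphic_map_on F unit_ball" "F ` unit_ball \<subseteq> unit_ball"
    and z: "norm z < 1" and w: "norm w < 1"
  shows "norm (mob (F z) (F w)) \<le> norm (mob z w)"
proof -
  have Fz: "norm (F z) < 1" using F(2) z by (auto simp: image_subset_iff)
  have FM: "(\<lambda>x. F (mob z x)) ` unit_ball \<subseteq> unit_ball"
    using F(2) norm_mob_less_1[OF z] by (auto simp: image_subset_iff)
  note 1 = holomorphic_map_comp(1)[OF mob_holomorphic(1)[OF z] F(1) mob_holomorphic(2)[OF z]]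
  note 2 = holomorphic_map_comp(1)[OF 1 mob_holomorphic(1)[OF Fz] FM]
  have "norm (mob (F z) (F (mob z (mob z w)))) \<le> norm (mob z w)"
    by (rule Schwarz_ball[OF 2]) (use FM norm_mob_less_1[OF Fz] norm_mob_less_1[OF z w] Fz in \<open>auto simp: image_subset_iff\<close>)
  then show ?thesis using mob_mob[OF z] w by simp
qed

text \<open>The scalar core of \<open>kobayashi_scaled_point\<close>, with x = |zeta|, y = |G|, R =
  |<w,G>|, T = |w|^2 and c = Re(zeta <w,G>). Hypothesis \<open>T\<close> is the Schwarz-Pick bound
  for w at G, and the left side is the numerator of the squared metric at zeta G. The extremal case
  is w parallel to G, as in one variable.\<close>

lemma golusin_real:
  fixes x y R T c :: real
  assumes x: "0 \<le> x" "x < 1" and y: "0 \<le> y" "y < 1" and R: "0 \<le> R" "R\<^sup>2 \<le> T * y\<^sup>2" "c \<le> x * R"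
    and T: "((1 - y\<^sup>2) * T + R\<^sup>2) / (1 - y\<^sup>2)\<^sup>2 \<le> 1 / (1 - x\<^sup>2)\<^sup>2"
  shows "y\<^sup>2 + 2 * c + (1 - x\<^sup>2 * y\<^sup>2) * x\<^sup>2 * T + x^4 * R\<^sup>2 \<le> ((x + y) * (1 - x * y) / (1 - x\<^sup>2))\<^sup>2"
proof -
  have x2: "1 - x\<^sup>2 > 0" and y2: "1 - y\<^sup>2 > 0" using x y by (auto simp: power_less_one_iff abs_square_less_1)
  \<comment> \<open>In one variable \<open>Q\<close> is the Schwarz-Pick bound for |g'| where |g| =
    y. After dividing R by it, the constraint becomes u \<le> y.\<close>
  define Q where "Q = (1 - y\<^sup>2) / (1 - x\<^sup>2)"
  define u where "u = R / Q"
  have Q: "Q > 0" "(1 - y\<^sup>2) = Q * (1 - x\<^sup>2)" using x2 y2 by (auto simp: Q_def)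
  have Ru: "R = u * Q" "u \<ge> 0" using Q R by (auto simp: u_def)
  have T1: "(1 - y\<^sup>2) * T + R\<^sup>2 \<le> Q\<^sup>2"
    using T x2 y2 by (simp add: Q_def field_simps power_divide)
  have "(1 - y\<^sup>2) * R\<^sup>2 \<le> y\<^sup>2 * (Q\<^sup>2 - R\<^sup>2)"
  proof -
    have "(1 - y\<^sup>2) * R\<^sup>2 \<le> (1 - y\<^sup>2) * (T * y\<^sup>2)" using R y2 by (intro mult_left_mono) auto
    also have "\<dots> = y\<^sup>2 * ((1 - y\<^sup>2) * T)" by simp
    also have "\<dots> \<le> y\<^sup>2 * (Q\<^sup>2 - R\<^sup>2)" using T1 by (intro mult_left_mono) auto
    finally show ?thesis .
  qed
  then have "R\<^sup>2 \<le> (y * Q)\<^sup>2" by (simp add: algebra_simps power_mult_distrib)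
  then have "R \<le> y * Q" using y Q by (auto intro: power2_le_imp_le)
  then have u: "u \<le> y" using Q by (simp add: u_def field_simps)
  have D: "1 - x\<^sup>2 * y\<^sup>2 = (1 - x\<^sup>2) * (Q + y\<^sup>2)"
    using Q(2) by (simp add: algebra_simps)
  have "(1 - x\<^sup>2 * y\<^sup>2) * T = (Q + y\<^sup>2) / Q * ((1 - y\<^sup>2) * T)"
    unfolding D Q(2) using Q(1) by (simp add: field_simps)
  also have "\<dots> \<le> (Q + y\<^sup>2) / Q * (Q\<^sup>2 - R\<^sup>2)"
    using T1 Q(1) by (intro mult_left_mono) auto
  also have "\<dots> = (Q + y\<^sup>2) * Q * (1 - u\<^sup>2)"
    using Q(1) unfolding Ru by (simp add: field_simps power2_eq_square)
  finally have T2: "x\<^sup>2 * ((1 - x\<^sup>2 * y\<^sup>2) * T) \<le> x\<^sup>2 * ((Q + y\<^sup>2) * Q * (1 - u\<^sup>2))"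
    by (intro mult_left_mono) auto
  have "x * (y + u) \<le> 1 * (y + u)" using x y Ru(2) by (intro mult_right_mono) auto
  then have "0 \<le> 2 - x * (y + u)" using u y by argo
  \<comment> \<open>Once T and c are replaced by their upper bounds, the gap between the two sides
    is exactly this product, which vanishes at u = y.\<close>
  then have "0 \<le> x * Q * (y - u) * (2 - x * (y + u))"
    using x Q(1) u by simp
  also have "\<dots> = (y + x * Q)\<^sup>2 - (y\<^sup>2 + 2 * (x * R) + x\<^sup>2 * ((Q + y\<^sup>2) * Q * (1 - u\<^sup>2)) + x^4 * R\<^sup>2)"
  proof -
    have e: "x\<^sup>2 * Q = Q - 1 + y\<^sup>2" using Q(2) by (simp add: algebra_simps)
    have "x^4 * R\<^sup>2 = x\<^sup>2 * u\<^sup>2 * Q * (x\<^sup>2 * Q)" unfolding Ru by (simp add: power2_eq_square power4_eq_xxxx)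
    then have "x^4 * R\<^sup>2 = x\<^sup>2 * u\<^sup>2 * Q * (Q - 1 + y\<^sup>2)" unfolding e .
    then show ?thesis unfolding Ru(1) by (simp add: algebra_simps power2_eq_square)
  qed
  finally have "y\<^sup>2 + 2 * c + (1 - x\<^sup>2 * y\<^sup>2) * x\<^sup>2 * T + x^4 * R\<^sup>2 \<le> (y + x * Q)\<^sup>2"
    using T2 R(3) by (simp add: algebra_simps)
  also have "y + x * Q = (x + y) * (1 - x * y) / (1 - x\<^sup>2)"
    using x2 by (simp add: Q_def field_simps power2_eq_square)
  finally show ?thesis .
qed

section \<open>Golusin's inequality\<close>

text \<open>To be read with G = g(zeta) and w = g'(zeta): by the product rule G + zeta w is the
  derivative of zeta g(zeta). The bound is the one-variable Golusin bound with |g(zeta)| in the role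
  of the modulus.\<close>

lemma kobayashi_scaled_point:
  assumes \<zeta>: "norm \<zeta> < 1" and G: "norm G < 1"
    and w: "kobayashi unit_ball G w \<le> 1 / (1 - (cmod \<zeta>)\<^sup>2)"
  shows "kobayashi unit_ball (\<zeta> *s G) (G + \<zeta> *s w) \<le>
    (cmod \<zeta> + norm G) / (1 + cmod \<zeta> * norm G) / (1 - (cmod \<zeta>)\<^sup>2)"
proof -
  define x y R T c where "x = cmod \<zeta>" and "y = norm G" and "R = cmod (herm w G)"
    and "T = (norm w)\<^sup>2" and "c = Re (\<zeta> * herm w G)"
  note defs = x_def y_def R_def T_def c_def
  have x: "0 \<le> x" "x < 1" and y: "0 \<le> y" "y < 1" using \<zeta> G by (auto simp: defs)
  have x2: "1 - x\<^sup>2 > 0" and y2: "1 - y\<^sup>2 > 0" using x y by (auto simp: abs_square_less_1)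
  have xy: "x * y < 1" using x y by (metis mult_less_cancel_right1 mult_mono order_le_less_trans mult.right_neutral mult_left_le less_imp_le)
  then have D: "1 - x\<^sup>2 * y\<^sup>2 > 0"
    using x y by (simp add: power_mult_distrib[symmetric] abs_square_less_1)
  have "R\<^sup>2 \<le> (norm w * norm G)\<^sup>2"
    unfolding R_def by (intro power_mono herm_Cauchy_Schwarz) simp
  then have R: "0 \<le> R" "R\<^sup>2 \<le> T * y\<^sup>2" by (simp_all add: defs power_mult_distrib)
  have c: "c \<le> x * R"
    unfolding defs norm_mult[symmetric] by (rule complex_Re_le_cmod)
  have "(kobayashi unit_ball G w)\<^sup>2 \<le> (1 / (1 - x\<^sup>2))\<^sup>2"
    using w kobayashi_ball(2)[OF G] by (intro power_mono) (auto simp: x_def)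
  then have T: "((1 - y\<^sup>2) * T + R\<^sup>2) / (1 - y\<^sup>2)\<^sup>2 \<le> 1 / (1 - x\<^sup>2)\<^sup>2"
    by (simp add: kobayashi_ball(1)[OF G] defs power_divide)
  have n: "norm (\<zeta> *s G) = x * y" by (simp add: norm_vec_scale defs)
  have "G + \<zeta> *s w = 1 *s G - (- \<zeta>) *s w" by (simp add: vec_eq_iff)
  then have "(norm (G + \<zeta> *s w))\<^sup>2 = y\<^sup>2 + 2 * Re (cnj (\<zeta> * herm w G)) + x\<^sup>2 * T"
    unfolding complex_cnj_mult cnj_herm
    by (simp only: norm_diff_scale_power2) (simp add: defs power_mult_distrib)
  then have v: "(norm (G + \<zeta> *s w))\<^sup>2 = y\<^sup>2 + 2 * c + x\<^sup>2 * T" by (simp add: c_def)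
  have "herm (G + \<zeta> *s w) (\<zeta> *s G) = cnj \<zeta> * (complex_of_real (y\<^sup>2) + \<zeta> * herm w G)"
    by (simp add: herm_simps herm_self y_def algebra_simps)
  then have "(cmod (herm (G + \<zeta> *s w) (\<zeta> *s G)))\<^sup>2 =
      x\<^sup>2 * (cmod (complex_of_real (y\<^sup>2) + \<zeta> * herm w G))\<^sup>2"
    by (simp add: norm_mult power_mult_distrib x_def)
  also have "(cmod (complex_of_real (y\<^sup>2) + \<zeta> * herm w G))\<^sup>2 =
      y^4 + 2 * y\<^sup>2 * c + (cmod (\<zeta> * herm w G))\<^sup>2"
    unfolding cmod_power2 c_def by (simp add: power2_eq_square power4_eq_xxxx algebra_simps)
  also have "(cmod (\<zeta> * herm w G))\<^sup>2 = x\<^sup>2 * R\<^sup>2" by (simp add: norm_mult power_mult_distrib defs)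
  finally have h: "(cmod (herm (G + \<zeta> *s w) (\<zeta> *s G)))\<^sup>2 = x\<^sup>2 * (y^4 + 2 * y\<^sup>2 * c + x\<^sup>2 * R\<^sup>2)" .
  have "(kobayashi unit_ball (\<zeta> *s G) (G + \<zeta> *s w))\<^sup>2 =
      (y\<^sup>2 + 2 * c + (1 - x\<^sup>2 * y\<^sup>2) * x\<^sup>2 * T + x^4 * R\<^sup>2) / (1 - x\<^sup>2 * y\<^sup>2)\<^sup>2"
  proof -
    have "(1 - (x * y)\<^sup>2) * (y\<^sup>2 + 2 * c + x\<^sup>2 * T) + x\<^sup>2 * (y^4 + 2 * y\<^sup>2 * c + x\<^sup>2 * R\<^sup>2) =
        y\<^sup>2 + 2 * c + (1 - x\<^sup>2 * y\<^sup>2) * x\<^sup>2 * T + x^4 * R\<^sup>2"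
      by (simp add: power_mult_distrib algebra_simps power2_eq_square power4_eq_xxxx)
    moreover have "norm (\<zeta> *s G) < 1" using xy n by simp
    ultimately show ?thesis
      by (simp only: kobayashi_ball(1) n v h) (simp only: power_mult_distrib)
  qed
  also have "\<dots> \<le> ((x + y) * (1 - x * y) / (1 - x\<^sup>2))\<^sup>2 / (1 - x\<^sup>2 * y\<^sup>2)\<^sup>2"
    by (intro divide_right_mono golusin_real x y R c T) simp
  also have "\<dots> = ((x + y) / (1 + x * y) / (1 - x\<^sup>2))\<^sup>2"
  proof -
    have "1 - x\<^sup>2 * y\<^sup>2 = (1 - x * y) * (1 + x * y)" by (simp add: algebra_simps power2_eq_square)
    then show ?thesis using xy by (simp add: power_divide power_mult_distrib)
  qed
  finally show ?thesis
    unfolding x_def[symmetric] y_def[symmetric] using x y x2 by (auto intro: power2_le_imp_le)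
qed

text \<open>As for \<open>N = 1\<close>, the inequality comes from the product rule for \<open>f \<zeta> = \<zeta> g \<zeta>\<close> together with the Schwarz--Pick lemma for \<open>g\<close>.\<close>

lemma golusin_disc:
  fixes f :: "complex \<Rightarrow> complex ^ 'n"
  assumes f: "holomorphic_disc f unit_ball" and f0: "f 0 = 0" and a: "norm (vderiv f 0) < 1"
    and \<zeta>: "norm \<zeta> < 1"
  shows "kobayashi unit_ball (f \<zeta>) (vderiv f \<zeta>) \<le>
    1 / (1 - (cmod \<zeta>)\<^sup>2) - (1 - norm (vderiv f 0)) / 16 * (1 - cmod \<zeta>)"
proof -
  define g where "g \<zeta> = (\<chi> j. if \<zeta> = 0 then deriv (\<lambda>\<zeta>. f \<zeta> $ j) 0 else f \<zeta> $ j / \<zeta>)" for \<zeta>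
  have fg: "f \<zeta> = \<zeta> *s g \<zeta>" for \<zeta>
    using f0 by (simp add: g_def vec_eq_iff)
  have g0: "g 0 = vderiv f 0" by (simp add: g_def vderiv_def)
  have lt: "norm (g \<zeta>) < 1" if \<zeta>: "norm \<zeta> < 1" for \<zeta>
  proof (cases "\<zeta> = 0")
    case False
    \<comment> \<open>Equality at one nonzero point would force |f' 0| = 1. The strict inequality
      keeps g in the open ball.\<close>
    have "norm (f \<zeta>) < norm \<zeta>"
      using Schwarz_disc(1)[OF f f0 \<zeta>] Schwarz_disc(3)[OF f f0] a False \<zeta> by fastforce
    then show ?thesis using False by (simp add: fg norm_vec_scale)
  qed (use a g0 in simp)
  have g: "holomorphic_disc g unit_ball"
    unfolding holomorphic_disc_def
  proof (intro conjI allI)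
    show "g ` ball 0 1 \<subseteq> ball 0 1" using lt by (auto simp: image_subset_iff)
    fix j
    show "(\<lambda>\<zeta>. g \<zeta> $ j) holomorphic_on ball 0 1"
      by (rule pole_theorem_open_0[of "\<lambda>\<zeta>. f \<zeta> $ j" _ 0])
        (use f f0 in \<open>auto simp: holomorphic_disc_def g_def\<close>)
  qed
  have "((\<lambda>\<zeta>. \<zeta> *s g \<zeta>) has_derivative (\<lambda>h. \<zeta> *s (h *s vderiv g \<zeta>) + h *s g \<zeta>)) (at \<zeta>)"
    by (rule has_derivative_vec_scale[OF has_derivative_ident holomorphic_discD(2)[OF g \<zeta>]])
  also have "(\<lambda>\<zeta>. \<zeta> *s g \<zeta>) = f" by (rule ext) (rule fg[symmetric])
  also have "(\<lambda>h. \<zeta> *s (h *s vderiv g \<zeta>) + h *s g \<zeta>) = (\<lambda>h. h *s (g \<zeta> + \<zeta> *s vderiv g \<zeta>))"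
    by (simp add: vec_eq_iff fun_eq_iff algebra_simps)
  finally have df: "vderiv f \<zeta> = g \<zeta> + \<zeta> *s vderiv g \<zeta>" by (rule vderiv_eqI)
  define x y a where "x = cmod \<zeta>" and "y = norm (g \<zeta>)" and "a = norm (vderiv f 0)"
  have x: "0 \<le> x" "x < 1" and y: "0 \<le> y" "y < 1" and a01: "0 \<le> a" "a < 1"
    using \<zeta> lt a by (auto simp: x_def y_def a_def)
  have x2: "1 - x\<^sup>2 > 0" and a2: "1 - a\<^sup>2 > 0" using x a01 by (auto simp: abs_square_less_1)
  \<comment> \<open>By Schwarz-Pick g(zeta) has pseudohyperbolic distance at most |zeta| from g(0),
    so g cannot approach the sphere faster than 1 - |zeta| up to a constant. The 4 bounds (1 + a)(1
    + y).\<close>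
  have y_bound: "1 - y \<ge> (1 - x) * (1 - a) / 4"
  proof -
    have g01: "norm (g 0) < 1" by (rule lt) simp
    note c = holomorphic_disc_comp[OF mob_holomorphic(1)[OF g01] g mob_holomorphic(2)[OF g01]]
    have "norm (mob (g 0) (g \<zeta>)) \<le> x"
      using Schwarz_disc(1)[OF c(1) _ \<zeta>] g01 by (simp add: x_def)
    then have "1 - x\<^sup>2 \<le> 1 - (norm (mob (g 0) (g \<zeta>)))\<^sup>2" by (simp add: power_mono)
    also have "\<dots> = (1 - a\<^sup>2) * (1 - y\<^sup>2) / (cmod (1 - herm (g \<zeta>) (g 0)))\<^sup>2"
      using one_minus_norm_mob[OF g01, of "g \<zeta>"] one_minus_herm_nonzero[OF g01, of "g \<zeta>"] lt[OF \<zeta>]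
      by (simp add: a_def y_def g0)
    also have "\<dots> \<le> (1 - a\<^sup>2) * (1 - y\<^sup>2) / (1 - a)\<^sup>2"
    proof (intro divide_left_mono power_mono)
      have *: "1 - a \<le> cmod (1 - herm (g \<zeta>) (g 0))"
        using one_minus_herm_nonzero(1)[OF g01, of "g \<zeta>"] lt[OF \<zeta>] by (simp add: a_def g0)
      then show "1 - a \<le> cmod (1 - herm (g \<zeta>) (g 0))" .
      show "0 < (cmod (1 - herm (g \<zeta>) (g 0)))\<^sup>2 * (1 - a)\<^sup>2"
        using * a01 by (intro mult_pos_pos zero_less_power) auto
      show "0 \<le> (1 - a\<^sup>2) * (1 - y\<^sup>2)" using a2 y by (intro mult_nonneg_nonneg) (simp_all add: power_le_one)
    qed (use a01 in auto)
    finally have "(1 - x\<^sup>2) * (1 - a)\<^sup>2 \<le> (1 - a\<^sup>2) * (1 - y\<^sup>2)"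
      using a01 by (simp add: field_simps)
    then have "(1 - a) * ((1 - x\<^sup>2) * (1 - a)) \<le> (1 - a) * ((1 + a) * (1 - y\<^sup>2))"
      by (simp add: algebra_simps power2_eq_square)
    then have 1: "(1 - x\<^sup>2) * (1 - a) \<le> (1 + a) * (1 - y\<^sup>2)"
      using a01 by (simp only: mult_le_cancel_left_pos diff_gt_0_iff_gt)
    have "(1 - x) * (1 - a) \<le> (1 - x\<^sup>2) * (1 - a)"
      using x a01 by (intro mult_right_mono) (auto simp: power2_eq_square mult_left_le)
    also note 1
    also have "(1 + a) * (1 - y\<^sup>2) \<le> 2 * (2 * (1 - y))"
    proof (rule mult_mono)
      have "(1 + y) * (1 - y) \<le> 2 * (1 - y)" using y by (intro mult_right_mono) auto
      then show "1 - y\<^sup>2 \<le> 2 * (1 - y)" by (simp add: algebra_simps power2_eq_square)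
    qed (use a01 y in \<open>auto simp: abs_square_le_1\<close>)
    finally show ?thesis by simp
  qed
  have "kobayashi unit_ball (f \<zeta>) (vderiv f \<zeta>) \<le> (x + y) / (1 + x * y) / (1 - x\<^sup>2)"
    unfolding df fg[of \<zeta>] x_def y_def
    by (rule kobayashi_scaled_point[OF \<zeta> lt[OF \<zeta>] kobayashi_disc[OF g \<zeta>]])
  also have "\<dots> \<le> (1 - (1 - x) * (1 - y) / 2) / (1 - x\<^sup>2)"
  proof (intro divide_right_mono)
    have xy: "0 \<le> x * y" "x * y \<le> 1" using x y by (auto intro: mult_le_one)
    have "(1 - x) * (1 - y) / 2 \<le> (1 - x) * (1 - y) / (1 + x * y)"
      by (rule divide_left_mono) (use x y xy in \<open>simp_all add: add_pos_nonneg\<close>)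
    also have "\<dots> = 1 - (x + y) / (1 + x * y)"
      using xy by (simp add: field_simps)
    finally show "(x + y) / (1 + x * y) \<le> 1 - (1 - x) * (1 - y) / 2" by linarith
  qed (use x2 in simp)
  also have "\<dots> = 1 / (1 - x\<^sup>2) - (1 - y) / (2 * (1 + x))"
  proof -
    have "1 - x\<^sup>2 = (1 - x) * (1 + x)" by (simp add: algebra_simps power2_eq_square)
    then have "(1 - x) * (1 - y) / 2 / (1 - x\<^sup>2) = (1 - y) / (2 * (1 + x))" using x by simp
    then show ?thesis by (simp only: diff_divide_distrib)
  qed
  also have "\<dots> \<le> 1 / (1 - x\<^sup>2) - (1 - a) / 16 * (1 - x)"
  proof -
    \<comment> \<open>The 16 collects the 4 of \<open>y_bound\<close> and the bound 2 (1 + x) \<le>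
      4.\<close>
    have "(1 - a) / 16 * (1 - x) \<le> (1 - y) / 4" using y_bound by (simp add: field_simps)
    also have "\<dots> \<le> (1 - y) / (2 * (1 + x))" using x y by (intro divide_left_mono) auto
    finally show ?thesis by simp
  qed
  finally show ?thesis by (simp add: x_def a_def)
qed

section \<open>Slices through a boundary point\<close>

lemma boundary_dist_ball:
  fixes z :: "complex ^ 'n"
  assumes z: "norm z \<le> 1"
  shows "boundary_dist unit_ball z = 1 - norm z"
  unfolding boundary_dist_def
proof (rule cInf_eq_minimum)
  obtain w :: "complex ^ 'n" where w: "norm w = 1" "norm (z - w) = 1 - norm z"
  proof (cases "z = 0")
    case True
    then show ?thesis using that[of "axis undefined 1"] by (simp add: norm_axis_1)
  next
    case False
    then have "z - sgn z = - (1 - norm z) *\<^sub>R sgn z"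
      by (simp add: algebra_simps sgn_div_norm)
    then have "norm (z - sgn z) = 1 - norm z"
      using False z by (simp add: norm_sgn del: scaleR_minus_left minus_diff_eq)
    then show ?thesis using that[of "sgn z"] False by (simp add: norm_sgn)
  qed
  then show "1 - norm z \<in> {norm (z - w) |w. w \<notin> unit_ball}" by (auto intro!: exI[of _ w])
  show "1 - norm z \<le> x" if x: "x \<in> {norm (z - w) |w. w \<notin> unit_ball}" for x
  proof -
    obtain w where "w \<notin> unit_ball" "x = norm (z - w)" using x by blast
    then show ?thesis using norm_triangle_ineq2[of w z] by (simp add: norm_minus_commute)
  qed
qed

text \<open>The slice of the ball through \<open>z\<close> and the boundary point \<open>e\<close> is parametrized by
  \<open>\<zeta> \<mapsto> mob z (\<zeta> u)\<close> with \<open>u = mob z e\<close>.\<close>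

lemma mob_slice:
  fixes z e :: "complex ^ 'n"
  assumes z: "norm z < 1" and e: "norm e = 1" and \<zeta>: "norm \<zeta> \<le> 1"
  defines "u \<equiv> mob z e" and "\<kappa> \<equiv> herm (mob z e) z"
  shows "norm u = 1" "mob z u = e" "cmod \<kappa> \<le> norm z" "1 - norm z \<le> cmod (1 - \<zeta> * \<kappa>)"
    "cmod (1 - \<zeta> * \<kappa>) \<le> 2"
    "mob z (\<zeta> *s u) = e - ((1 - \<zeta>) / (1 - \<zeta> * \<kappa>)) *s (e - z)"
    "dmob z (\<zeta> *s u) u = ((1 - \<kappa>) / (1 - \<zeta> * \<kappa>)\<^sup>2) *s (e - z)"
proof -
  show u: "norm u = 1" unfolding u_def by (rule norm_mob_eq_1[OF z e])
  show mu: "mob z u = e" unfolding u_def by (rule mob_mob[OF z]) (simp add: e)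
  show \<kappa>: "cmod \<kappa> \<le> norm z"
    using herm_Cauchy_Schwarz[of u z] u by (simp add: \<kappa>_def u_def)
  have h: "herm u z = \<kappa>" "herm (\<zeta> *s u) z = \<zeta> * \<kappa>" by (simp_all add: \<kappa>_def u_def herm_simps)
  have nz: "norm (\<zeta> *s u) \<le> 1" using \<zeta> u by (simp add: norm_vec_scale)
  show lo: "1 - norm z \<le> cmod (1 - \<zeta> * \<kappa>)"
    using one_minus_herm_nonzero(1)[OF z nz] by (simp add: h)
  have "cmod (\<zeta> * \<kappa>) \<le> 1 * 1" unfolding norm_mult using \<zeta> \<kappa> z by (intro mult_mono) auto
  then show "cmod (1 - \<zeta> * \<kappa>) \<le> 2" using norm_triangle_ineq4[of 1 "\<zeta> * \<kappa>"] by simp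
  have D: "1 - \<zeta> * \<kappa> \<noteq> 0" using lo z by auto
  have D1: "1 - \<kappa> \<noteq> 0" using \<kappa> z by auto
  define s where "s = mob_scale z"
  have s: "1 + s \<noteq> 0" using mob_scale_props[OF z] by (simp add: s_def)
  define k where "k = \<kappa> / (1 + s)"
  \<comment> \<open>The relation \<open>mob z u = e\<close> is solved for s u. This eliminates u,
    and the formulas involve only e, z and the number \<kappa>.\<close>
  have "e $ j = (1 / (1 - \<kappa>)) * ((1 - k) * z $ j - s * u $ j)" for j
    unfolding mu[symmetric] by (simp add: mob_def[of z u] h s_def[symmetric] k_def divide_inverse algebra_simps)
  then have su: "s * u $ j = (1 - k) * z $ j - (1 - \<kappa>) * e $ j" for j
    using D1 by (simp add: field_simps)
  have m: "mob z (\<zeta> *s u) $ j = e $ j - (1 - \<zeta>) / (1 - \<zeta> * \<kappa>) * (e $ j - z $ j)" for j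
  proof -
    have "mob z (\<zeta> *s u) $ j = ((1 - \<zeta> * k) * z $ j - \<zeta> * (s * u $ j)) / (1 - \<zeta> * \<kappa>)"
      by (simp add: mob_def h s_def[symmetric] k_def divide_inverse algebra_simps)
    also have "\<dots> = e $ j - (1 - \<zeta>) / (1 - \<zeta> * \<kappa>) * (e $ j - z $ j)"
      unfolding su using D by (simp add: divide_simps) (simp add: algebra_simps)
    finally show ?thesis .
  qed
  then show "mob z (\<zeta> *s u) = e - ((1 - \<zeta>) / (1 - \<zeta> * \<kappa>)) *s (e - z)"
    by (simp add: vec_eq_iff del: vector_ssub_ldistrib)
  have "dmob z (\<zeta> *s u) u $ j = ((1 - \<kappa>) / (1 - \<zeta> * \<kappa>)\<^sup>2) * (e $ j - z $ j)" for j
  proof -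
    have "dmob z (\<zeta> *s u) u $ j =
        (- k * z $ j - s * u $ j + \<kappa> * mob z (\<zeta> *s u) $ j) / (1 - \<zeta> * \<kappa>)"
      by (simp add: dmob_def h s_def[symmetric] k_def divide_inverse algebra_simps)
    also have "\<dots> = ((1 - \<kappa>) / (1 - \<zeta> * \<kappa>)\<^sup>2) * (e $ j - z $ j)"
      unfolding su m using D
      by (simp add: divide_simps) (simp add: algebra_simps power2_eq_square)
    finally show ?thesis .
  qed
  then show "dmob z (\<zeta> *s u) u = ((1 - \<kappa>) / (1 - \<zeta> * \<kappa>)\<^sup>2) *s (e - z)"
    by (simp add: vec_eq_iff del: vector_ssub_ldistrib)
qed

text \<open>For fixed z, both the distance to the sphere and the distance to e are controlled by 1 -
  t, so the points with real parameter approach e non-tangentially. The constants come from |1 - t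
  \<kappa>| lying between 1 - |z| and 2.\<close>

lemma one_minus_norm_mob_slice:
  fixes z e :: "complex ^ 'n"
  assumes z: "norm z < 1" and e: "norm e = 1" and t: "0 \<le> t" "t < 1"
  defines "W \<equiv> mob z (complex_of_real t *s mob z e)"
  shows "(1 - (norm z)\<^sup>2) * (1 - t) / 4 \<le> 1 - (norm W)\<^sup>2" "norm (W - e) \<le> 2 * (1 - t) / (1 - norm z)"
proof -
  define \<kappa> where "\<kappa> = herm (mob z e) z"
  note S = mob_slice[OF z e, of "complex_of_real t", folded \<kappa>_def]
  have n: "cmod (complex_of_real t) \<le> 1" using t by simp
  have D: "1 - norm z \<le> cmod (1 - complex_of_real t * \<kappa>)" "cmod (1 - complex_of_real t * \<kappa>) \<le> 2"
    using S(4,5) n by auto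
  have "1 - (norm W)\<^sup>2 = (1 - (norm z)\<^sup>2) * (1 - t\<^sup>2) / (cmod (1 - complex_of_real t * \<kappa>))\<^sup>2"
    unfolding W_def using D z t
    by (subst one_minus_norm_mob) (auto simp: herm_simps \<kappa>_def norm_vec_scale norm_mob_eq_1[OF z e])
  also have "\<dots> \<ge> (1 - (norm z)\<^sup>2) * (1 - t) / 2\<^sup>2"
  proof (intro frac_le mult_mono power_mono)
    show "1 - t \<le> 1 - t\<^sup>2" using t by (simp add: power2_eq_square mult_left_le)
  qed (use z t D in \<open>auto simp: abs_square_le_1\<close>)
  finally show "(1 - (norm z)\<^sup>2) * (1 - t) / 4 \<le> 1 - (norm W)\<^sup>2" by simp
  have "W - e = - ((1 - complex_of_real t) / (1 - complex_of_real t * \<kappa>)) *s (e - z)"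
    unfolding W_def using S(6) n by (simp add: vec_eq_iff)
  then have "norm (W - e) = cmod (1 - complex_of_real t) / cmod (1 - complex_of_real t * \<kappa>) * norm (e - z)"
    by (simp only: norm_vec_scale norm_minus_cancel norm_divide)
  also have "\<dots> = (1 - t) * norm (e - z) / cmod (1 - complex_of_real t * \<kappa>)"
  proof -
    have "cmod (1 - complex_of_real t) = 1 - t"
      using t by (metis norm_of_real abs_of_nonneg diff_ge_0_iff_ge less_imp_le of_real_1 of_real_diff)
    then show ?thesis by simp
  qed
  also have "\<dots> \<le> (1 - t) * 2 / (1 - norm z)"
    using D z t e norm_triangle_ineq4[of e z] by (intro frac_le mult_mono) auto
  finally show "norm (W - e) \<le> 2 * (1 - t) / (1 - norm z)" by (simp add: mult.commute)
qed

text \<open>The slice disc, pushed forward by F and recentred at F z, is a disc f with f 0 = 0. If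
  |f' 0| = a < 1, then \<open>golusin_disc\<close> gives a loss of at least (1 - a)/16 (1 - t) in
  Kobayashi length at t, while (b) makes the loss smaller than any multiple of 1 - t. So |f' 0| = 1,
  and the Schwarz lemma makes f linear.\<close>

lemma slice_isometry:
  fixes F :: "complex ^ 'n \<Rightarrow> complex ^ 'n"
  assumes F: "holomorphic_map_on F unit_ball" "F ` unit_ball \<subseteq> unit_ball"
    and e: "norm e = 1"
    and b: "\<And>v M. norm v = 1 \<Longrightarrow> herm v e \<noteq> 0 \<Longrightarrow> M > 1 \<Longrightarrow>
      (\<lambda>z. kobayashi unit_ball (F z) (frechet_derivative F (at z) v) - kobayashi unit_ball z v)
         \<in> o[at e within (nontang_region e M \<inter> complex_line v e)](boundary_dist unit_ball)"
    and z: "norm z < 1"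
  shows "\<exists>p. norm p = 1 \<and> (\<forall>\<zeta>. norm \<zeta> < 1 \<longrightarrow> mob (F z) (F (mob z (\<zeta> *s mob z e))) = \<zeta> *s p)"
proof -
  define u \<kappa> where "u = mob z e" and "\<kappa> = herm u z"
  note S = mob_slice[OF z e, folded u_def, folded \<kappa>_def]
  have u: "norm u = 1" using S(1)[of 0] by simp
  define \<psi> where "\<psi> \<zeta> = mob z (\<zeta> *s u)" for \<zeta>
  note l = holomorphic_disc_line[OF eq_refl[OF u]]
  note c0 = holomorphic_disc_comp[OF mob_holomorphic(1)[OF z] l(1) mob_holomorphic(2)[OF z]]
  have \<psi>: "holomorphic_disc \<psi> unit_ball" "vderiv \<psi> \<zeta> = dmob z (\<zeta> *s u) u" if "norm \<zeta> < 1" for \<zeta>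
    using c0(1) c0(2)[of \<zeta>]
      mob_holomorphic(3)[OF z, of "\<zeta> *s u"] l(2)[of \<zeta>] that u
    by (auto simp: \<psi>_def[abs_def] norm_vec_scale)
  have \<psi>0: "holomorphic_disc \<psi> unit_ball" using \<psi>(1)[of 0] by simp
  have Fz: "norm (F z) < 1" using F(2) z by (auto simp: image_subset_iff)
  define f where "f \<zeta> = mob (F z) (F (\<psi> \<zeta>))" for \<zeta>
  note c1 = holomorphic_disc_comp[OF F(1) \<psi>0 F(2)]
  note c2 = holomorphic_disc_comp[OF mob_holomorphic(1)[OF Fz] c1(1) mob_holomorphic(2)[OF Fz]]
  have f: "holomorphic_disc f unit_ball" using c2(1) by (simp add: f_def[abs_def])
  have f0: "f 0 = 0" using Fz by (simp add: f_def \<psi>_def)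
  define a where "a = norm (vderiv f 0)"
  define v where "v = sgn (e - z)"
  have ez: "e \<noteq> z" using e z by auto
  then have v: "norm v = 1" "complex_of_real (norm (e - z)) *s v = e - z"
    by (auto simp: v_def norm_sgn norm_scale_sgn)
  \<comment> \<open>The pairing of v with e is a positive multiple of 1 - <z,e>, which is nonzero
    inside the ball. So (b) is available for the direction of this slice.\<close>
  have "complex_of_real (norm (e - z)) * herm v e = 1 - herm z e"
    unfolding herm_scale_left[symmetric] v(2) by (simp add: herm_simps herm_self e)
  moreover have "cmod (herm z e) < 1" using herm_Cauchy_Schwarz[of z e] e z by simp
  ultimately have ve: "herm v e \<noteq> 0" by auto
  have "a = 1"
  proof (rule ccontr)
    assume "a \<noteq> 1"
    then have a: "a < 1" using Schwarz_disc(2)[OF f f0] by (simp add: a_def)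
    define d where "d = 1 - norm z"
    have d: "d > 0" "d \<le> 1" using z by (auto simp: d_def)
    have z2: "1 - (norm z)\<^sup>2 \<ge> d" using z by (simp add: d_def power2_eq_square mult_left_le)
    \<comment> \<open>The aperture is the quotient of |W - e| \<le> 2 (1 - t)/d by 1 - |W| \<ge> d
      (1 - t)/8.\<close>
    define M where "M = 16 / (d * d) + 1"
    \<comment> \<open>Chosen so that 4/d^2 times \<epsilon> times 2/d equals (1 - a)/32, half of the
      constant in Golusin's loss.\<close>
    define \<epsilon> where "\<epsilon> = (1 - a) * d ^ 3 / 256"
    have M: "M > 1" and \<epsilon>: "\<epsilon> > 0" using d a by (auto simp: M_def \<epsilon>_def)
    let ?h = "\<lambda>z. kobayashi unit_ball (F z) (frechet_derivative F (at z) v) - kobayashi unit_ball z v"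
    have "\<forall>\<^sub>F z in at e within (nontang_region e M \<inter> complex_line v e).
        norm (?h z) \<le> \<epsilon> * norm (boundary_dist unit_ball z)"
      by (rule landau_o.smallD[OF b[OF v(1) ve M] \<epsilon>])
    then obtain r where r: "r > 0" "\<And>w. w \<in> nontang_region e M \<inter> complex_line v e \<Longrightarrow> w \<noteq> e \<Longrightarrow>
        dist w e < r \<Longrightarrow> norm (?h w) \<le> \<epsilon> * norm (boundary_dist unit_ball w)"
      unfolding eventually_at by blast
    \<comment> \<open>Close enough to 1 that 2 (1 - t)/d \<le> r/2, which puts W into the
      neighbourhood where the little-o bound holds.\<close>
    define t where "t = max 0 (1 - r * d / 4)"
    have "1 - r * d / 4 \<le> t" by (simp add: t_def)
    moreover have "0 \<le> t" "t < 1" using r d by (auto simp: t_def)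
    ultimately have t: "0 \<le> t" "t < 1" "1 - t \<le> r * d / 4" by auto
    have nt: "cmod (complex_of_real t) < 1" "cmod (complex_of_real t) \<le> 1" using t by auto
    define W where "W = \<psi> (complex_of_real t)"
    note W = one_minus_norm_mob_slice[OF z e t(1,2), folded u_def, folded \<psi>_def, folded W_def]
    have W1: "norm W < 1" unfolding W_def using holomorphic_discD(1)[OF \<psi>0 nt(1)] by simp
    have "(1 - norm W) * (1 + norm W) \<le> (1 - norm W) * 2" using W1 by (intro mult_left_mono) auto
    then have "1 - (norm W)\<^sup>2 \<le> 2 * (1 - norm W)" by (simp add: algebra_simps power2_eq_square)
    moreover have "d * (1 - t) \<le> (1 - (norm z)\<^sup>2) * (1 - t)" using z2 t by (intro mult_right_mono) auto
    ultimately have W2: "1 - norm W \<ge> d * (1 - t) / 8" using W(1) by simp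
    have W3: "norm (W - e) \<le> 2 * (1 - t) / d" using W(2) by (simp add: d_def)
    have "norm (W - e) \<le> M * (1 - norm W)"
    proof -
      have "2 * (1 - t) / d = 16 / (d * d) * (d * (1 - t) / 8)" using d by (simp add: field_simps)
      also have "\<dots> \<le> M * (1 - norm W)" using W2 M t d W1 by (intro mult_mono) (auto simp: M_def)
      finally show ?thesis using W3 by simp
    qed
    then have "W \<in> nontang_region e M" using W1 by (simp add: nontang_region_def boundary_dist_ball)
    moreover have "W \<in> complex_line v e"
    proof -
      define k where "k = (1 - complex_of_real t) / (1 - complex_of_real t * \<kappa>)"
      have "W = e - k *s (complex_of_real (norm (e - z)) *s v)"
        unfolding W_def \<psi>_def S(6)[OF nt(2)] v(2) k_def ..
      then have "W = (- (k * complex_of_real (norm (e - z)))) *s v + e" by (simp add: vec_eq_iff)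
      then show ?thesis unfolding complex_line_def by blast
    qed
    moreover have "dist W e < r"
    proof -
      have "2 * (1 - t) / d \<le> 2 * (r * d / 4) / d" using t(3) d by (intro divide_right_mono mult_left_mono) auto
      also have "\<dots> < r" using r d by simp
      finally show ?thesis using W3 by (simp add: dist_norm)
    qed
    moreover have "W \<noteq> e" using W1 e by auto
    ultimately have "norm (?h W) \<le> \<epsilon> * norm (boundary_dist unit_ball W)" by (intro r(2)) auto
    also have "norm (boundary_dist unit_ball W) \<le> 2 * (1 - t) / d"
      using W1 W3 e norm_triangle_ineq2[of e W] by (simp add: boundary_dist_ball norm_minus_commute)
    finally have h: "norm (?h W) \<le> \<epsilon> * (2 * (1 - t) / d)" using \<epsilon> by (simp add: mult_left_mono)
    \<comment> \<open>Condition (b) concerns the fixed unit vector v, whereas the tangent of the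
      slice disc is \<mu> v. Homogeneity of the metric converts one into the other, at the cost of a
      factor at most 4/d^2.\<close>
    define \<mu> where "\<mu> = (1 - \<kappa>) / (1 - complex_of_real t * \<kappa>)\<^sup>2 * complex_of_real (norm (e - z))"
    have d\<psi>: "vderiv \<psi> (complex_of_real t) = \<mu> *s v" "dmob z (complex_of_real t *s u) u = \<mu> *s v"
      unfolding \<psi>(2)[OF nt(1)] S(7)[OF nt(2)] \<mu>_def vector_smult_assoc[symmetric] v(2) by simp_all
    have \<mu>: "cmod \<mu> \<le> 4 / d\<^sup>2"
    proof -
      have "cmod (1 - \<kappa>) \<le> 2" "norm (e - z) \<le> 2" "d \<le> cmod (1 - complex_of_real t * \<kappa>)"
        using S(5)[of 1] norm_triangle_ineq4[of e z] e z S(4)[OF nt(2)] by (simp_all add: d_def)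
      then have "cmod (1 - \<kappa>) / (cmod (1 - complex_of_real t * \<kappa>))\<^sup>2 * norm (e - z) \<le> 2 / d\<^sup>2 * 2"
        using d by (intro mult_mono frac_le power_mono) auto
      then show ?thesis by (simp add: \<mu>_def norm_mult norm_divide norm_power)
    qed
    have FW: "norm (F W) < 1" using F(2) W1 by (auto simp: image_subset_iff)
    have "vderiv f (complex_of_real t) = dmob (F z) (F W) (frechet_derivative F (at W) (\<mu> *s v))"
      using c2(2)[OF nt(1)] c1(2)[OF nt(1)] mob_holomorphic(3)[OF Fz, of "F W"] FW
      by (simp add: f_def[abs_def] W_def d\<psi>)
    then have "kobayashi unit_ball (f (complex_of_real t)) (vderiv f (complex_of_real t)) =
        kobayashi unit_ball (F W) (frechet_derivative F (at W) (\<mu> *s v))"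
      using kobayashi_mob[OF Fz FW] by (simp add: f_def W_def)
    also have "\<dots> = cmod \<mu> * kobayashi unit_ball (F W) (frechet_derivative F (at W) v)"
      using holomorphic_mapD(2)[OF F(1), of W] W1 kobayashi_ball(3)[OF FW] by simp
    finally have k1: "kobayashi unit_ball (f (complex_of_real t)) (vderiv f (complex_of_real t)) =
      cmod \<mu> * kobayashi unit_ball (F W) (frechet_derivative F (at W) v)" .
    have tu: "norm (complex_of_real t *s u) = t" using u t by (simp add: norm_vec_scale)
    have t2: "1 - t\<^sup>2 > 0" using t by (simp add: abs_square_less_1)
    have "kobayashi unit_ball W (\<mu> *s v) = kobayashi unit_ball (complex_of_real t *s u) u"
      using kobayashi_mob[OF z, of "complex_of_real t *s u" u] tu t unfolding d\<psi>(2) W_def \<psi>_def by simp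
    also have "\<dots> = 1 / (1 - t\<^sup>2)"
    proof (rule power2_eq_imp_eq)
      show "(kobayashi unit_ball (complex_of_real t *s u) u)\<^sup>2 = (1 / (1 - t\<^sup>2))\<^sup>2"
        using t by (subst kobayashi_ball(1)) (simp_all add: tu u herm_simps herm_self power_divide)
    qed (use t2 kobayashi_ball(2)[of "complex_of_real t *s u" u] tu t in auto)
    finally have k2: "cmod \<mu> * kobayashi unit_ball W v = 1 / (1 - t\<^sup>2)"
      using kobayashi_ball(3)[OF W1] by simp
    have "(1 - a) / 16 * (1 - t) \<le> cmod \<mu> * (kobayashi unit_ball W v - kobayashi unit_ball (F W) (frechet_derivative F (at W) v))"
      using golusin_disc[OF f f0 a[unfolded a_def] nt(1)] t k1 k2 by (simp add: a_def right_diff_distrib)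
    also have "\<dots> \<le> 4 / d\<^sup>2 * (\<epsilon> * (2 * (1 - t) / d))"
    proof (rule order_trans[OF mult_left_mono mult_right_mono])
      show "kobayashi unit_ball W v - kobayashi unit_ball (F W) (frechet_derivative F (at W) v) \<le> \<epsilon> * (2 * (1 - t) / d)"
        using h by simp
    qed (use \<mu> \<epsilon> d t in auto)
    also have "\<dots> = (1 - a) / 32 * (1 - t)"
      using d by (simp add: \<epsilon>_def field_simps power2_eq_square power3_eq_cube)
    finally show False using a t by (simp add: mult_le_cancel_right)
  qed
  then have n: "norm (vderiv f 0) = 1" by (simp add: a_def)
  show ?thesis
  proof (intro exI conjI allI impI)
    show "norm (vderiv f 0) = 1" by (rule n)
    fix \<zeta> :: complex assume "norm \<zeta> < 1"
    then have "f \<zeta> = \<zeta> *s vderiv f 0" using Schwarz_disc(3)[OF f f0] n by blast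
    then show "mob (F z) (F (mob z (\<zeta> *s mob z e))) = \<zeta> *s vderiv f 0"
      by (simp only: f_def \<psi>_def u_def)
  qed
qed

section \<open>Rigidity\<close>

text \<open>On each complex line through 0 the equality case of the Schwarz lemma makes H linear,
  with the derivative of H at 0 as slope. Hence H agrees with that derivative on the whole
  ball.\<close>

lemma norm_preserving_linear:
  fixes H :: "complex ^ 'n \<Rightarrow> complex ^ 'n"
  assumes H: "holomorphic_map_on H unit_ball" and n: "\<And>z. norm z < 1 \<Longrightarrow> norm (H z) = norm z"
  obtains U where "linear U" "\<And>c v. U (c *s v) = c *s U v" "\<And>v. norm (U v) = norm v"
    "\<And>z. norm z < 1 \<Longrightarrow> H z = U z"
proof
  let ?U = "frechet_derivative H (at 0)"
  show "linear ?U" using holomorphic_mapD(1)[OF H, of 0] by (auto intro: has_derivative_linear)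
  show scale: "?U (c *s v) = c *s ?U v" for c v using holomorphic_mapD(2)[OF H, of 0] by simp
  have im: "H ` unit_ball \<subseteq> unit_ball" using n by (auto simp: image_subset_iff)
  have *: "norm (?U p) = 1 \<and> (\<forall>\<zeta>. norm \<zeta> < 1 \<longrightarrow> H (\<zeta> *s p) = \<zeta> *s ?U p)" if p: "norm p = 1" for p
  proof -
    note l = holomorphic_disc_line[OF eq_refl[OF p]]
    note c = holomorphic_disc_comp[OF H l(1) im]
    have "vderiv (\<lambda>\<zeta>. H (\<zeta> *s p)) 0 = ?U p" using c(2)[of 0] l(2) by simp
    moreover have "\<exists>\<zeta>. norm \<zeta> < 1 \<and> \<zeta> \<noteq> 0 \<and> norm (H (\<zeta> *s p)) = norm \<zeta>"
      by (rule exI[of _ "1/2"]) (simp add: n norm_vec_scale p norm_divide)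
    ultimately show ?thesis using Schwarz_disc(3)[OF c(1)] n[of 0] by auto
  qed
  show "norm (?U v) = norm v" for v
  proof (cases "v = 0")
    case True
    then show ?thesis using scale[of 0 0] by simp
  next
    case False
    then show ?thesis
      using *[of "sgn v"] scale[of "complex_of_real (norm v)" "sgn v"]
      by (simp add: norm_sgn norm_scale_sgn norm_vec_scale)
  qed
  show "H z = ?U z" if z: "norm z < 1" for z
  proof (cases "z = 0")
    case True
    then show ?thesis using scale[of 0 0] n[of 0] by simp
  next
    case False
    then have "H (complex_of_real (norm z) *s sgn z) = complex_of_real (norm z) *s ?U (sgn z)"
      using *[of "sgn z"] z by (simp add: norm_sgn)
    then show ?thesis by (simp add: scale[symmetric] norm_scale_sgn)
  qed
qed

lemma holomorphic_linear_isometry: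
  fixes U :: "complex ^ 'n \<Rightarrow> complex ^ 'n"
  assumes U: "linear U" "\<And>c v. U (c *s v) = c *s U v" "\<And>v. norm (U v) = norm v"
  shows "holomorphic_map_on U D" "frechet_derivative U (at z) = U" "U ` unit_ball \<subseteq> unit_ball"
proof -
  have d: "(U has_derivative U) (at z)" for z
    using U(1) by (simp add: linear_conv_bounded_linear bounded_linear_imp_has_derivative)
  show "holomorphic_map_on U D" by (rule holomorphic_mapI[OF d U(2)])
  show "frechet_derivative U (at z) = U" using frechet_derivative_at[OF d] by metis
  show "U ` unit_ball \<subseteq> unit_ball" using U(3) by auto
qed

lemma inverse_linear_isometry:
  fixes U :: "complex ^ 'n \<Rightarrow> complex ^ 'n"
  assumes U: "linear U" "\<And>c v. U (c *s v) = c *s U v" "\<And>v. norm (U v) = norm v"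
  shows "linear (inv U)" "inv U (c *s v) = c *s inv U v" "norm (inv U v) = norm v"
    "U (inv U v) = v" "inv U (U v) = v"
proof -
  have "inj U"
    using U(1,3) by (metis linear_injective_0 norm_eq_zero)
  moreover have "surj U" by (rule linear_inj_imp_surj[OF U(1) \<open>inj U\<close>])
  ultimately show 1: "U (inv U v) = v" "inv U (U v) = v" for v by (simp_all add: surj_f_inv_f)
  show "linear (inv U)" by (rule inj_linear_imp_inv_linear[OF U(1) \<open>inj U\<close>])
  show "inv U (c *s v) = c *s inv U v" using 1 U(2) by metis
  show "norm (inv U v) = norm v" using 1 U(3) by metis
qed

text \<open>\<open>inv_into D F\<close> need agree with G only on E. Openness of E is what lets the
  derivative carry over.\<close>

lemma biholomorphismI:
  assumes F: "holomorphic_map_on F D" "F ` D \<subseteq> E" and G: "holomorphic_map_on G E" "G ` E \<subseteq> D"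
    and inv: "\<And>z. z \<in> D \<Longrightarrow> G (F z) = z" "\<And>w. w \<in> E \<Longrightarrow> F (G w) = w" and E: "open E"
  shows "biholomorphism F D E"
proof -
  have bij: "bij_betw F D E"
    by (rule bij_betwI[of _ _ _ G]) (use F(2) G(2) inv in auto)
  have "inv_into D F w = G w" if "w \<in> E" for w
    using inv_into_f_eq[OF bij_betw_imp_inj_on[OF bij], of "G w" w] G(2) inv(2) that by auto
  then have "holomorphic_map_on (inv_into D F) E"
    by (rule holomorphic_map_transform(1)[OF G(1) E])
  with F bij show ?thesis by (simp add: biholomorphism_def)
qed

text \<open>Along the slice through \<open>z\<close> and \<open>e\<close>, the preserved pseudo-distance and \<open>|F w| \<le> |w|\<close>
  give, as \<open>w \<rightarrow> e\<close>, a Julia-type inequality which says that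
  \<open>q z = (1 - \<langle>z, e\<rangle>) / (1 - \<langle>F z, u\<rangle>)\<close> is bounded by \<open>1 = q 0\<close>.\<close>

lemma rigidity_fixing_0:
  fixes F :: "complex ^ 'n \<Rightarrow> complex ^ 'n"
  assumes F: "holomorphic_map_on F unit_ball" "F ` unit_ball \<subseteq> unit_ball" "F 0 = 0"
    and e: "norm e = 1"
    and slice: "\<And>z. norm z < 1 \<Longrightarrow>
      \<exists>p. norm p = 1 \<and> (\<forall>\<zeta>. norm \<zeta> < 1 \<longrightarrow> mob (F z) (F (mob z (\<zeta> *s mob z e))) = \<zeta> *s p)"
    and z: "norm z < 1"
  shows "norm (F z) = norm z"
proof -
  have FB: "norm (F z) < 1" if "norm z < 1" for z using F(2) that by (auto simp: image_subset_iff)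
  have Fle: "norm (F z) \<le> norm z" if "norm z < 1" for z by (rule Schwarz_ball[OF F that])
  obtain p where p: "norm p = 1" "\<And>\<zeta>. norm \<zeta> < 1 \<Longrightarrow> mob (F 0) (F (mob 0 (\<zeta> *s mob 0 e))) = \<zeta> *s p"
    using slice[of 0] by auto
  \<comment> \<open>At centre 0 the involution is minus the identity, which accounts for the
    sign.\<close>
  define u where "u = - p"
  have u: "norm u = 1" "\<And>\<zeta>. norm \<zeta> < 1 \<Longrightarrow> F (\<zeta> *s e) = \<zeta> *s u"
    using p by (auto simp: u_def F(3) mob_zero_left minus_equation_iff)
  have julia: "(1 - (norm (F z))\<^sup>2) * (cmod (1 - herm z e))\<^sup>2 \<le> (1 - (norm z)\<^sup>2) * (cmod (1 - herm (F z) u))\<^sup>2"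
    if z: "norm z < 1" for z
  proof -
    define d where "d = 1 - norm z"
    have d: "d > 0" "d \<le> 1" using z by (auto simp: d_def)
    have z2: "1 - (norm z)\<^sup>2 \<ge> d" using z by (simp add: d_def power2_eq_square mult_left_le)
    define W where "W t = mob z (complex_of_real t *s mob z e)" for t
    obtain p where p: "norm p = 1" "\<And>\<zeta>. norm \<zeta> < 1 \<Longrightarrow> mob (F z) (F (mob z (\<zeta> *s mob z e))) = \<zeta> *s p"
      using slice[OF z] by auto
    have W: "norm (W t) < 1" "norm (W t - e) \<le> 2 * (1 - t) / d" "d * (1 - t) / 4 \<le> 1 - (norm (W t))\<^sup>2"
      "norm (mob z (W t)) = t" "norm (mob (F z) (F (W t))) = t" if t: "0 < t" "t < 1" for t
    proof -
      note S = one_minus_norm_mob_slice[OF z e less_imp_le[OF t(1)] t(2), folded W_def]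
      have u: "norm (mob z e) = 1" by (rule norm_mob_eq_1[OF z e])
      then have tu: "norm (complex_of_real t *s mob z e) = t" using t by (simp add: norm_vec_scale)
      then show "norm (W t) < 1" unfolding W_def using t by (intro norm_mob_less_1[OF z]) simp
      show "norm (W t - e) \<le> 2 * (1 - t) / d" using S(2) t by (simp add: d_def)
      have "d * (1 - t) \<le> (1 - (norm z)\<^sup>2) * (1 - t)" using z2 t by (intro mult_right_mono) auto
      then show "d * (1 - t) / 4 \<le> 1 - (norm (W t))\<^sup>2" using S(1) by linarith
      show "norm (mob z (W t)) = t" unfolding W_def using mob_mob[OF z] tu t by simp
      show "norm (mob (F z) (F (W t))) = t"
        unfolding W_def using p t by (simp add: norm_vec_scale)
    qed
    have nz: "1 - herm x y \<noteq> 0" if "norm x < 1" "norm y < 1" for x y :: "complex ^ 'n"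
      using one_minus_herm_nonzero(2)[of y x] that by simp
    \<comment> \<open>Both pseudohyperbolic distances from the centre equal t. In the resulting
      identity |F W| \<le> |W| allows 1 - |F W|^2 to be replaced by the smaller 1 - |W|^2, which
      then cancels.\<close>
    have ineq: "(1 - (norm (F z))\<^sup>2) * (cmod (1 - herm (W t) z))\<^sup>2 \<le>
        (1 - (norm z)\<^sup>2) * (cmod (1 - herm (F (W t)) (F z)))\<^sup>2" if t: "0 < t" "t < 1" for t
    proof -
      note W = W[OF t]
      let ?A = "(cmod (1 - herm (F (W t)) (F z)))\<^sup>2" and ?B = "(cmod (1 - herm (W t) z))\<^sup>2"
      have pos: "?A > 0" "?B > 0" using nz W FB z by auto
      have pos2: "0 < 1 - (norm (W t))\<^sup>2" "0 \<le> 1 - (norm (F z))\<^sup>2"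
        using W FB[OF z] by (auto simp: abs_square_less_1 power_le_one)
      have "(1 - (norm (F z))\<^sup>2) * (1 - (norm (F (W t)))\<^sup>2) / ?A = 1 - t\<^sup>2"
        using one_minus_norm_mob[OF FB[OF z], of "F (W t)"] W nz FB z by simp
      also have "\<dots> = (1 - (norm z)\<^sup>2) * (1 - (norm (W t))\<^sup>2) / ?B"
        using one_minus_norm_mob[OF z, of "W t"] W nz z by simp
      finally have "(1 - (norm (F z))\<^sup>2) * (1 - (norm (F (W t)))\<^sup>2) * ?B = (1 - (norm z)\<^sup>2) * (1 - (norm (W t))\<^sup>2) * ?A"
        by (rule frac_eq_eq[THEN iffD1, rotated 2]) (use pos in auto)
      moreover have "(1 - (norm (F z))\<^sup>2) * (1 - (norm (W t))\<^sup>2) * ?B \<le> (1 - (norm (F z))\<^sup>2) * (1 - (norm (F (W t)))\<^sup>2) * ?B"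
        using pos2 pos Fle[OF W(1)] by (intro mult_right_mono mult_left_mono) (auto intro: power_mono)
      ultimately have "(1 - (norm (W t))\<^sup>2) * ((1 - (norm (F z))\<^sup>2) * ?B) \<le> (1 - (norm (W t))\<^sup>2) * ((1 - (norm z)\<^sup>2) * ?A)"
        by (simp add: mult_ac)
      then show ?thesis using pos2 by (simp only: mult_le_cancel_left_pos)
    qed
    have ev: "\<forall>\<^sub>F t in at_left 1. t \<in> {0<..<(1::real)}" by (rule eventually_at_left_real) simp
    have We: "(W \<longlongrightarrow> e) (at_left 1)"
    proof (rule Lim_null[THEN iffD2], rule Lim_null_comparison)
      show "\<forall>\<^sub>F t in at_left 1. norm (W t - e) \<le> 2 * (1 - t) / d"
        using ev by eventually_elim (use W(2) in auto)
      have "((\<lambda>t. 2 * (1 - t) / d) \<longlongrightarrow> 2 * (1 - 1) / d) (at_left 1)" by (intro tendsto_intros) (use d in auto)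
      then show "((\<lambda>t. 2 * (1 - t) / d) \<longlongrightarrow> 0) (at_left 1)" by simp
    qed
    \<comment> \<open>The slice through an arbitrary z must end at the same u as the radial one. W
      is compared with the radial point t e, whose image t u is known: contraction gives A^2 (1 -
      |W|^2) \<le> B^2. With B \<le> 3 (1 - t)/d and 1 - |W|^2 \<ge> d (1 - t)/4 this yields A^2
      \<le> 36 (1 - t)/d^3, so <F W, u> tends to 1.\<close>
    have near: "norm (F (W t) - u) \<le> sqrt (2 * (sqrt (36 * (1 - t) / d ^ 3) + (1 - t)))"
      if t: "0 < t" "t < 1" for t
    proof -
      note W = W[OF t]
      have te: "norm (complex_of_real t *s e) < 1" using t e by (simp add: norm_vec_scale)
      have Fte: "F (complex_of_real t *s e) = complex_of_real t *s u" using u t by simp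
      have tu: "norm (complex_of_real t *s u) < 1" using t u by (simp add: norm_vec_scale)
      have ntu: "(norm (complex_of_real t *s u))\<^sup>2 = t\<^sup>2" "(norm (complex_of_real t *s e))\<^sup>2 = t\<^sup>2"
        using t u e by (simp_all add: norm_vec_scale)
      define A B where "A = cmod (1 - complex_of_real t * herm (F (W t)) u)"
        and "B = cmod (1 - complex_of_real t * herm (W t) e)"
      have A: "A = cmod (1 - herm (F (W t)) (complex_of_real t *s u))"
        and B: "B = cmod (1 - herm (W t) (complex_of_real t *s e))" by (simp_all add: A_def B_def herm_simps)
      have pos: "A > 0" "B > 0" unfolding A B using nz W FB te tu by auto
      have "norm (mob (complex_of_real t *s u) (F (W t))) \<le> norm (mob (complex_of_real t *s e) (W t))"
        using mob_contraction[OF F(1,2) te W(1)] by (simp add: Fte)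
      then have "1 - (norm (mob (complex_of_real t *s e) (W t)))\<^sup>2 \<le> 1 - (norm (mob (complex_of_real t *s u) (F (W t))))\<^sup>2"
        by (simp add: power_mono)
      moreover have "1 - (norm (mob (complex_of_real t *s e) (W t)))\<^sup>2 = (1 - t\<^sup>2) * ((1 - (norm (W t))\<^sup>2) / B\<^sup>2)"
        using one_minus_norm_mob[OF te, of "W t"] nz[OF W(1) te] by (simp add: B ntu)
      moreover have "1 - (norm (mob (complex_of_real t *s u) (F (W t))))\<^sup>2 = (1 - t\<^sup>2) * ((1 - (norm (F (W t)))\<^sup>2) / A\<^sup>2)"
        using one_minus_norm_mob[OF tu, of "F (W t)"] nz[OF FB[OF W(1)] tu] by (simp add: A ntu)
      moreover have "1 - t\<^sup>2 > 0" using t by (simp add: abs_square_less_1)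
      ultimately have "(1 - (norm (W t))\<^sup>2) / B\<^sup>2 \<le> (1 - (norm (F (W t)))\<^sup>2) / A\<^sup>2"
        by (simp only: mult_le_cancel_left_pos)
      also have "\<dots> \<le> 1 / A\<^sup>2" by (intro divide_right_mono) auto
      finally have AB: "A\<^sup>2 * (1 - (norm (W t))\<^sup>2) \<le> B\<^sup>2" using pos by (simp add: field_simps)
      have "1 - complex_of_real t * herm (W t) e = complex_of_real (1 - t) - complex_of_real t * herm (W t - e) e"
        by (simp add: herm_simps herm_self e algebra_simps)
      then have "B \<le> cmod (complex_of_real (1 - t)) + cmod (complex_of_real t * herm (W t - e) e)"
        unfolding B_def by (metis norm_triangle_ineq4)
      also have "\<dots> \<le> (1 - t) + 1 * (2 * (1 - t) / d)"
        unfolding norm_mult using t herm_Cauchy_Schwarz[of "W t - e" e] W(2) e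
        by (intro add_mono mult_mono) (auto simp del: of_real_diff)
      also have "\<dots> \<le> (1 - t) / d + 2 * (1 - t) / d"
      proof -
        have "(1 - t) * d \<le> 1 - t" using t d by (simp add: mult_left_le)
        then have "1 - t \<le> (1 - t) / d" using d by (simp only: pos_le_divide_eq)
        then show ?thesis by simp
      qed
      finally have "B \<le> 3 * (1 - t) / d" by (simp add: add_divide_distrib[symmetric])
      then have "B\<^sup>2 \<le> (3 * (1 - t) / d)\<^sup>2" using pos by (intro power_mono) auto
      moreover have "A\<^sup>2 * (d * (1 - t) / 4) \<le> A\<^sup>2 * (1 - (norm (W t))\<^sup>2)"
        by (intro mult_left_mono W) auto
      ultimately have "A\<^sup>2 * (d * (1 - t) / 4) \<le> (3 * (1 - t) / d)\<^sup>2" using AB by linarith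
      also have "\<dots> = 36 * (1 - t) / d ^ 3 * (d * (1 - t) / 4)"
        using d by (simp add: field_simps power2_eq_square power3_eq_cube)
      finally have "A\<^sup>2 \<le> 36 * (1 - t) / d ^ 3"
        by (rule mult_right_le_imp_le) (use d t in simp)
      then have A_le: "A \<le> sqrt (36 * (1 - t) / d ^ 3)" by (rule real_le_rsqrt)
      have "1 - Re (herm (F (W t)) u) \<le> cmod (1 - herm (F (W t)) u)"
        using complex_Re_le_cmod[of "1 - herm (F (W t)) u"] by simp
      also have "1 - herm (F (W t)) u = (1 - complex_of_real t * herm (F (W t)) u) - complex_of_real (1 - t) * herm (F (W t)) u"
        by (simp add: algebra_simps)
      also have "cmod \<dots> \<le> A + cmod (complex_of_real (1 - t) * herm (F (W t)) u)"
        unfolding A_def by (rule norm_triangle_ineq4)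
      also have "cmod (complex_of_real (1 - t) * herm (F (W t)) u) \<le> (1 - t) * 1"
        unfolding norm_mult using t herm_Cauchy_Schwarz[of "F (W t)" u] u(1) FB[OF W(1)]
        by (intro mult_mono) (auto simp del: of_real_diff)
      finally have R: "1 - Re (herm (F (W t)) u) \<le> sqrt (36 * (1 - t) / d ^ 3) + (1 - t)" using A_le by simp
      have "(norm (F (W t) - u))\<^sup>2 = (norm (F (W t)))\<^sup>2 - 2 * Re (herm (F (W t)) u) + 1"
        using norm_diff_scale_power2[of 1 "F (W t)" 1 u] u(1) by simp
      also have "\<dots> \<le> 2 * (1 - Re (herm (F (W t)) u))"
        using FB[OF W(1)] by (simp add: power_le_one)
      also have "\<dots> \<le> 2 * (sqrt (36 * (1 - t) / d ^ 3) + (1 - t))"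
        by (rule mult_left_mono[OF R]) simp
      finally show ?thesis by (rule real_le_rsqrt)
    qed
    have FWu: "((\<lambda>t. F (W t)) \<longlongrightarrow> u) (at_left 1)"
    proof (rule Lim_null[THEN iffD2], rule Lim_null_comparison)
      show "\<forall>\<^sub>F t in at_left 1. norm (F (W t) - u) \<le> sqrt (2 * (sqrt (36 * (1 - t) / d ^ 3) + (1 - t)))"
        using ev by eventually_elim (use near in auto)
      have "((\<lambda>t. sqrt (2 * (sqrt (36 * (1 - t) / d ^ 3) + (1 - t)))) \<longlongrightarrow>
          sqrt (2 * (sqrt (36 * (1 - 1) / d ^ 3) + (1 - 1)))) (at_left 1)"
        by (intro tendsto_intros) (use d in auto)
      then show "((\<lambda>t. sqrt (2 * (sqrt (36 * (1 - t) / d ^ 3) + (1 - t)))) \<longlongrightarrow> 0) (at_left 1)" by simp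
    qed
    have "(1 - (norm (F z))\<^sup>2) * (cmod (1 - herm e z))\<^sup>2 \<le> (1 - (norm z)\<^sup>2) * (cmod (1 - herm u (F z)))\<^sup>2"
    proof (rule tendsto_le[of "at_left 1"])
      show "((\<lambda>t. (1 - (norm (F z))\<^sup>2) * (cmod (1 - herm (W t) z))\<^sup>2) \<longlongrightarrow>
          (1 - (norm (F z))\<^sup>2) * (cmod (1 - herm e z))\<^sup>2) (at_left 1)"
        by (intro tendsto_intros We)
      show "((\<lambda>t. (1 - (norm z)\<^sup>2) * (cmod (1 - herm (F (W t)) (F z)))\<^sup>2) \<longlongrightarrow>
          (1 - (norm z)\<^sup>2) * (cmod (1 - herm u (F z)))\<^sup>2) (at_left 1)"
        by (intro tendsto_intros FWu)
      show "\<forall>\<^sub>F t in at_left 1. (1 - (norm (F z))\<^sup>2) * (cmod (1 - herm (W t) z))\<^sup>2 \<le>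
          (1 - (norm z)\<^sup>2) * (cmod (1 - herm (F (W t)) (F z)))\<^sup>2"
        using ev by eventually_elim (use ineq in auto)
    qed simp
    moreover have "cmod (1 - herm e z) = cmod (1 - herm z e)" "cmod (1 - herm u (F z)) = cmod (1 - herm (F z) u)"
      by (metis cnj_herm complex_cnj_diff complex_cnj_one complex_mod_cnj)+
    ultimately show ?thesis by simp
  qed
  have nzu: "1 - herm (F z) u \<noteq> 0" if "norm z < 1" for z
    using herm_Cauchy_Schwarz[of "F z" u] u(1) FB[OF that] by auto
  have q_le: "cmod ((1 - herm z e) / (1 - herm (F z) u)) \<le> 1" if z: "norm z < 1" for z
  proof -
    have pos: "0 < 1 - (norm (F z))\<^sup>2" using FB[OF z] by (simp add: abs_square_less_1)
    have "(1 - (norm (F z))\<^sup>2) * (cmod (1 - herm z e))\<^sup>2 \<le> (1 - (norm z)\<^sup>2) * (cmod (1 - herm (F z) u))\<^sup>2"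
      by (rule julia[OF z])
    also have "\<dots> \<le> (1 - (norm (F z))\<^sup>2) * (cmod (1 - herm (F z) u))\<^sup>2"
      using Fle[OF z] by (intro mult_right_mono) (auto intro: power_mono)
    finally have "(cmod (1 - herm z e))\<^sup>2 \<le> (cmod (1 - herm (F z) u))\<^sup>2"
      using pos by (simp only: mult_le_cancel_left_pos)
    then have "cmod (1 - herm z e) \<le> cmod (1 - herm (F z) u)" by (rule power2_le_imp_le) simp
    then show ?thesis using nzu[OF z] by (simp add: norm_divide divide_le_eq)
  qed
  have eq: "herm (F z) u = herm z e"
  proof -
    have p: "norm (sgn z) \<le> 1" by (simp add: norm_sgn)
    note l = holomorphic_disc_line[OF p]
    note c = holomorphic_disc_comp[OF F(1) l(1) F(2)]
    define Q where "Q \<zeta> = (1 - herm (\<zeta> *s sgn z) e) / (1 - herm (F (\<zeta> *s sgn z)) u)" for \<zeta>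
    have ball: "norm (\<zeta> *s sgn z) < 1" if "norm \<zeta> < 1" for \<zeta>
      using holomorphic_discD(1)[OF l(1) that] by simp
    have "Q holomorphic_on ball 0 1"
      unfolding Q_def using nzu ball
      by (intro holomorphic_intros holomorphic_herm_disc(1)[OF l(1)] holomorphic_herm_disc(1)[OF c(1)]) auto
    moreover have "norm (Q \<zeta>) \<le> norm (Q 0)" if "\<zeta> \<in> ball 0 1" for \<zeta>
      using q_le[OF ball, of \<zeta>] that by (simp add: Q_def F(3))
    ultimately have "Q constant_on ball 0 1"
      by (intro maximum_modulus_principle[of Q "ball 0 1" "ball 0 1" 0]) auto
    then have "Q (complex_of_real (norm z)) = Q 0"
      unfolding constant_on_def using z by (metis abs_norm_cancel mem_ball_0 norm_of_real norm_zero zero_less_one)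
    then have "(1 - herm z e) / (1 - herm (F z) u) = 1" by (simp add: Q_def norm_scale_sgn F(3))
    then show ?thesis using nzu[OF z] by simp
  qed
  \<comment> \<open>Now the two squared moduli in \<open>julia\<close> coincide and cancel. What
    remains is the reverse of the Schwarz inequality at z.\<close>
  have "0 < (cmod (1 - herm z e))\<^sup>2" using nzu[OF z] eq by simp
  with julia[OF z] have "1 - (norm (F z))\<^sup>2 \<le> 1 - (norm z)\<^sup>2" unfolding eq by simp
  then have "(norm z)\<^sup>2 \<le> (norm (F z))\<^sup>2" by simp
  then have "norm z \<le> norm (F z)" by (rule power2_le_imp_le) simp
  with Fle[OF z] show ?thesis by simp
qed

text \<open>The normalization F 0 = 0 is reached by an involution on the target side only. It leaves
  e, the approach regions and the slices untouched and preserves the Kobayashi lengths in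
  (b).\<close>

lemma kobayashi_asymptotics_imp_biholomorphism:
  fixes F :: "complex ^ 'n \<Rightarrow> complex ^ 'n"
  assumes F: "holomorphic_map_on F unit_ball" "F ` unit_ball \<subseteq> unit_ball"
    and e: "norm e = 1"
    and b: "\<And>v M. norm v = 1 \<Longrightarrow> herm v e \<noteq> 0 \<Longrightarrow> M > 1 \<Longrightarrow>
      (\<lambda>z. kobayashi unit_ball (F z) (frechet_derivative F (at z) v) - kobayashi unit_ball z v)
         \<in> o[at e within (nontang_region e M \<inter> complex_line v e)](boundary_dist unit_ball)"
  shows "biholomorphism F unit_ball unit_ball"
proof -
  define a where "a = F 0"
  have a: "norm a < 1" using F(2) by (auto simp: a_def image_subset_iff)
  have FB: "norm (F z) < 1" if "norm z < 1" for z using F(2) that by (auto simp: image_subset_iff)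
  define H where "H z = mob a (F z)" for z
  note comp = holomorphic_map_comp[OF F(1) mob_holomorphic(1)[OF a] F(2)]
  have H: "holomorphic_map_on H unit_ball" "H ` unit_ball \<subseteq> unit_ball" "H 0 = 0"
    using comp(1) F(2) mob_holomorphic(2)[OF a] a by (auto simp: H_def[abs_def] image_subset_iff a_def)
  have k: "kobayashi unit_ball (H z) (frechet_derivative H (at z) v) =
      kobayashi unit_ball (F z) (frechet_derivative F (at z) v)" if z: "norm z < 1" for z v
    using comp(2)[of z v] kobayashi_mob[OF a FB[OF z]] mob_holomorphic(3)[OF a, of "F z"] FB[OF z] z
    by (simp add: H_def[abs_def])
  have bH: "(\<lambda>z. kobayashi unit_ball (H z) (frechet_derivative H (at z) v) - kobayashi unit_ball z v)
         \<in> o[at e within (nontang_region e M \<inter> complex_line v e)](boundary_dist unit_ball)"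
    if v: "norm v = 1" "herm v e \<noteq> 0" "M > 1" for v M
  proof (subst landau_o.small.in_cong)
    show "\<forall>\<^sub>F z in at e within (nontang_region e M \<inter> complex_line v e).
        kobayashi unit_ball (H z) (frechet_derivative H (at z) v) - kobayashi unit_ball z v =
        kobayashi unit_ball (F z) (frechet_derivative F (at z) v) - kobayashi unit_ball z v"
      unfolding eventually_at by (intro exI[of _ 1]) (auto simp: nontang_region_def k)
  qed (rule b[OF v])
  have "norm (H z) = norm z" if "norm z < 1" for z
    by (rule rigidity_fixing_0[OF H e slice_isometry[OF H(1,2) e bH] that])
  then obtain U where U: "linear U" "\<And>c v. U (c *s v) = c *s U v" "\<And>v. norm (U v) = norm v"
    and HU: "\<And>z. norm z < 1 \<Longrightarrow> H z = U z"
    using norm_preserving_linear[OF H(1)] by blast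
  note V = inverse_linear_isometry[OF U]
  note hV = holomorphic_linear_isometry[OF V(1,2,3)]
  define G where "G w = inv U (mob a w)" for w
  show ?thesis
  proof (rule biholomorphismI[OF F, of G])
    show "holomorphic_map_on G unit_ball"
      unfolding G_def by (rule holomorphic_map_comp(1)[OF mob_holomorphic(1)[OF a] hV(1) mob_holomorphic(2)[OF a]])
    show "G ` unit_ball \<subseteq> unit_ball"
      using norm_mob_less_1[OF a] V(3) by (auto simp: G_def)
    show "G (F z) = z" if "z \<in> unit_ball" for z
      using HU[of z] that V(5) by (simp add: G_def H_def)
    show "F (G w) = w" if w: "w \<in> unit_ball" for w
    proof -
      have Gw: "norm (G w) < 1" using w norm_mob_less_1[OF a, of w] V(3) by (simp add: G_def)
      then have "mob a (F (G w)) = mob a w" using HU[OF Gw] V(4) by (simp add: H_def G_def)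
      then have "mob a (mob a (F (G w))) = mob a (mob a w)" by simp
      then show ?thesis using mob_mob[OF a] FB[OF Gw] w by simp
    qed
  qed simp
qed

section \<open>Automorphisms: bounded derivative and the tangential projection\<close>

lemma biholomorphism_inverse:
  assumes "biholomorphism F D E"
  obtains G where "holomorphic_map_on F D" "F ` D \<subseteq> E" "holomorphic_map_on G E" "G ` E \<subseteq> D"
    "\<And>z. z \<in> D \<Longrightarrow> G (F z) = z" "\<And>w. w \<in> E \<Longrightarrow> F (G w) = w"
proof
  note b = assms[unfolded biholomorphism_def]
  show "holomorphic_map_on F D" "holomorphic_map_on (inv_into D F) E" using b by auto
  show "F ` D \<subseteq> E" using b by (simp add: bij_betw_def)
  show "inv_into D F ` E \<subseteq> D" using b inv_into_into by (force simp: bij_betw_def)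
  show "inv_into D F (F z) = z" if "z \<in> D" for z using b that by (simp add: bij_betw_def)
  show "F (inv_into D F w) = w" if "w \<in> E" for w
    using b that f_inv_into_f by (force simp: bij_betw_def)
qed

text \<open>Each of the three terms of the numerator has norm at most |v|, and the denominator is at
  least 1 - |a| in modulus. The bound is uniform up to the sphere.\<close>

lemma norm_dmob_le:
  assumes a: "norm a < 1" and z: "norm z < 1"
  shows "norm (dmob a z v) \<le> 3 / (1 - norm a) * norm v"
proof -
  define s where "s = mob_scale a"
  note S = mob_scale_props[OF a, folded s_def]
  have "(Re s)\<^sup>2 \<le> 1\<^sup>2" using S(9) by simp
  then have s1: "cmod s \<le> 1" using S(6,8) by (simp add: abs_square_le_1)
  have s2: "1 \<le> cmod (1 + s)" using S(6) complex_Re_le_cmod[of "1 + s"] by simp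
  have h: "cmod (herm v a) \<le> norm v"
    using herm_Cauchy_Schwarz[of v a] a by (meson mult_left_le norm_ge_zero order_trans less_imp_le)
  have "norm ((herm v a / (1 + s)) *s a) \<le> norm v * 1"
    unfolding norm_vec_scale norm_divide
  proof (intro mult_mono)
    have "cmod (herm v a) / cmod (1 + s) \<le> norm v / 1" using h s2 by (intro frac_le) auto
    then show "cmod (herm v a) / cmod (1 + s) \<le> norm v" by simp
  qed (use a in auto)
  moreover have "norm (s *s v) \<le> 1 * norm v" unfolding norm_vec_scale using s1 by (intro mult_right_mono) auto
  moreover have "norm (herm v a *s mob a z) \<le> norm v * 1"
    unfolding norm_vec_scale using h norm_mob_less_1[OF a z] by (intro mult_mono) auto
  moreover have "- (herm v a / (1 + s)) *s a - s *s v + herm v a *s mob a z =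
      - ((herm v a / (1 + s)) *s a) - s *s v + herm v a *s mob a z" by (simp add: vec_eq_iff)
  ultimately have n: "norm (- (herm v a / (1 + s)) *s a - s *s v + herm v a *s mob a z) \<le> 3 * norm v"
    using norm_triangle_ineq[of "- ((herm v a / (1 + s)) *s a) - s *s v" "herm v a *s mob a z"]
      norm_triangle_ineq4[of "- ((herm v a / (1 + s)) *s a)" "s *s v"] by simp
  have "norm (dmob a z v) = norm (- (herm v a / (1 + s)) *s a - s *s v + herm v a *s mob a z) / cmod (1 - herm z a)"
    unfolding dmob_def s_def[symmetric] norm_vec_scale norm_inverse by (simp only: divide_inverse mult.commute)
  also have "\<dots> \<le> 3 * norm v / (1 - norm a)"
    using n one_minus_herm_nonzero(1)[OF a, of z] a z by (intro frac_le) auto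
  finally show ?thesis by simp
qed

text \<open>With a = F 0, the map H = \<open>mob a\<close> after F and its inverse K both fix 0, so
  the Schwarz lemma in both directions makes H preserve norms. Hence H is a linear isometry U, and F
  is \<open>mob a\<close> after U because \<open>mob a\<close> is an involution.\<close>

lemma automorphism_bounded_derivative:
  fixes F :: "complex ^ 'n \<Rightarrow> complex ^ 'n"
  assumes "biholomorphism F unit_ball unit_ball"
  shows "\<exists>C. \<forall>z v. norm z < 1 \<longrightarrow> norm (frechet_derivative F (at z) v) \<le> C * norm v"
proof -
  obtain G where F: "holomorphic_map_on F unit_ball" "F ` unit_ball \<subseteq> unit_ball"
    and G: "holomorphic_map_on G unit_ball" "G ` unit_ball \<subseteq> unit_ball"
    and inv: "\<And>z. z \<in> unit_ball \<Longrightarrow> G (F z) = z" "\<And>w. w \<in> unit_ball \<Longrightarrow> F (G w) = w"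
    using biholomorphism_inverse[OF assms] by blast
  have FB: "norm (F z) < 1" if "norm z < 1" for z using F(2) that by (auto simp: image_subset_iff)
  define a where "a = F 0"
  have a: "norm a < 1" using FB by (simp add: a_def)
  define H K where "H z = mob a (F z)" and "K w = G (mob a w)" for z w
  have H: "holomorphic_map_on H unit_ball" "H ` unit_ball \<subseteq> unit_ball" "H 0 = 0"
    using holomorphic_map_comp(1)[OF F(1) mob_holomorphic(1)[OF a] F(2)] F(2) mob_holomorphic(2)[OF a] a
    by (auto simp: H_def[abs_def] image_subset_iff a_def)
  have K: "holomorphic_map_on K unit_ball" "K ` unit_ball \<subseteq> unit_ball" "K 0 = 0"
    using holomorphic_map_comp(1)[OF mob_holomorphic(1)[OF a] G(1) mob_holomorphic(2)[OF a]]
      G(2) mob_holomorphic(2)[OF a] inv(1)[of 0]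
    by (auto simp: K_def[abs_def] image_subset_iff a_def)
  have "norm (H z) = norm z" if z: "norm z < 1" for z
  proof (rule antisym[OF Schwarz_ball[OF H z]])
    have "K (H z) = z" using mob_mob[OF a, of "F z"] FB[OF z] inv(1)[of z] z by (simp add: K_def H_def)
    moreover have "norm (H z) < 1" using H(2) z by (auto simp: image_subset_iff)
    ultimately show "norm z \<le> norm (H z)" using Schwarz_ball[OF K, of "H z"] by simp
  qed
  then obtain U where U: "linear U" "\<And>c v. U (c *s v) = c *s U v" "\<And>v. norm (U v) = norm v"
    and HU: "\<And>z. norm z < 1 \<Longrightarrow> H z = U z"
    using norm_preserving_linear[OF H(1)] by blast
  note hU = holomorphic_linear_isometry[OF U]
  note c = holomorphic_map_comp[OF hU(1)[of unit_ball] mob_holomorphic(1)[OF a] hU(3)]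
  have FU: "F z = mob a (U z)" if "z \<in> unit_ball" for z
    using HU[of z] mob_mob[OF a, of "F z"] FB[of z] that by (auto simp: H_def)
  have "frechet_derivative F (at z) v = dmob a (U z) (U v)" if z: "norm z < 1" for z v
    using holomorphic_map_transform(2)[OF c(1) open_ball FU, of z] c(2)[of z v] z hU(2) U(3)
      mob_holomorphic(3)[OF a, of "U z"] by simp
  then have "norm (frechet_derivative F (at z) v) \<le> 3 / (1 - norm a) * norm v" if "norm z < 1" for z v
    using norm_dmob_le[OF a, of "U z" "U v"] that U(3) by simp
  then show ?thesis by blast
qed

text \<open>This includes z = 0, where \<open>closest_point\<close> selects some point of the
  sphere, so sequences with F(z_k) = 0 for some k need no separate treatment.\<close>

lemma norm_boundary_proj: "norm (boundary_proj (z :: complex ^ 'n)) = 1"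
proof -
  have f: "frontier (unit_ball :: (complex ^ 'n) set) = sphere 0 1" by (simp add: frontier_ball)
  have "closest_point (sphere 0 1) z \<in> sphere (0 :: complex ^ 'n) 1"
    by (rule closest_point_in_set) auto
  then show ?thesis by (simp add: boundary_proj_def f)
qed

text \<open>The definite description is resolved as v - <v,p> p: two candidates differ by a tangent
  vector orthogonal to itself. The estimate is then Pythagoras.\<close>

lemma norm_tangent_proj_le:
  assumes p: "norm p = 1"
  shows "norm (tangent_proj p v) \<le> norm v"
proof -
  define w where "w = v - herm v p *s p"
  have pp: "herm p p = 1" using p by (simp add: herm_self)
  have w: "w \<in> complex_tangent p" "\<forall>u\<in>complex_tangent p. herm (v - w) u = 0"
  proof -
    show "w \<in> complex_tangent p" by (simp add: w_def complex_tangent_def herm_simps pp)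
    show "\<forall>u\<in>complex_tangent p. herm (v - w) u = 0"
      by (auto simp: w_def complex_tangent_def herm_simps) (metis cnj_herm complex_cnj_zero)
  qed
  have "tangent_proj p v = w"
    unfolding tangent_proj_def
  proof (rule the_equality)
    fix x assume x: "x \<in> complex_tangent p \<and> (\<forall>u\<in>complex_tangent p. herm (v - x) u = 0)"
    have "x - w \<in> complex_tangent p" using x w(1) by (simp add: complex_tangent_def herm_simps)
    then have "herm (v - x) (x - w) = 0" "herm (v - w) (x - w) = 0" using x w(2) by blast+
    then have "herm ((v - w) - (v - x)) (x - w) = 0" unfolding herm_diff_left[of "v - w" "v - x"] by simp
    then have "herm (x - w) (x - w) = 0" by simp
    then show "x = w" by (simp add: herm_self)
  qed (use w in auto)
  moreover have "(norm w)\<^sup>2 = (norm v)\<^sup>2 - (cmod (herm v p))\<^sup>2"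
  proof -
    have "complex_of_real ((norm w)\<^sup>2) = complex_of_real ((norm v)\<^sup>2 - (cmod (herm v p))\<^sup>2)"
      unfolding herm_self[symmetric] of_real_diff complex_norm_square
      using cnj_herm[of v p] by (simp add: w_def herm_simps pp algebra_simps)
    then show ?thesis by (simp only: of_real_eq_iff)
  qed
  ultimately have "(norm (tangent_proj p v))\<^sup>2 \<le> (norm v)\<^sup>2" by simp
  then show ?thesis by (rule power2_le_imp_le) simp
qed

text \<open>A finite index type has no distinguished first element, so an arbitrary index
  \<open>j1\<close> stands for it. The condition on the coordinate of v says that <v,e1> is nonzero,
  which is the form used above for an arbitrary unit vector e.\<close>

theorem theorem2p3:
  fixes F :: "complex ^ 'n \<Rightarrow> complex ^ 'n" and j1 :: 'n and e1 :: "complex ^ 'n"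
  assumes e1: "e1 = axis j1 1"
    and hol: "holomorphic_map_on F unit_ball"
    and self: "F ` unit_ball \<subseteq> unit_ball"
  shows "biholomorphism F unit_ball unit_ball \<longleftrightarrow>
    (\<forall>v. norm v = 1 \<and> v $ j1 \<noteq> 0 \<longrightarrow>
      (\<forall>z. (\<forall>k. z k \<in> unit_ball \<inter> complex_line v e1) \<and> nontang_tendsto z e1 \<and>
           \<not> (\<exists>w\<in>unit_ball. accumulation_point (\<lambda>k. F (z k)) w) \<longrightarrow>
         limsup (\<lambda>k. ereal (norm (tangent_proj (boundary_proj (F (z k)))
                                   (frechet_derivative F (at (z k)) v)))) < \<infinity>) \<and>
      (\<forall>M>1. (\<lambda>z. kobayashi unit_ball (F z) (frechet_derivative F (at z) v)
                   - kobayashi unit_ball z v)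
         \<in> o[at e1 within (nontang_region e1 M \<inter> complex_line v e1)](boundary_dist unit_ball)))"
    (is "_ \<longleftrightarrow> ?R")
proof
  assume R: ?R
  show "biholomorphism F unit_ball unit_ball"
  proof (rule kobayashi_asymptotics_imp_biholomorphism[OF hol self, of e1])
    show "norm e1 = 1" by (simp add: e1 norm_axis_1)
  qed (use R in \<open>simp add: e1 herm_axis\<close>)
next
  assume F: "biholomorphism F unit_ball unit_ball"
  then obtain G where G: "holomorphic_map_on G unit_ball" "G ` unit_ball \<subseteq> unit_ball"
    "\<And>z. z \<in> unit_ball \<Longrightarrow> G (F z) = z"
    using biholomorphism_inverse by metis
  obtain C where C: "\<And>z v. norm z < 1 \<Longrightarrow> norm (frechet_derivative F (at z) v) \<le> C * norm v"
    using automorphism_bounded_derivative[OF F] by blast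
  show ?R
  proof (intro allI impI conjI)
    fix v and z :: "nat \<Rightarrow> complex ^ 'n"
    assume "(\<forall>k. z k \<in> unit_ball \<inter> complex_line v e1) \<and> nontang_tendsto z e1 \<and>
           \<not> (\<exists>w\<in>unit_ball. accumulation_point (\<lambda>k. F (z k)) w)"
    then have "norm (tangent_proj (boundary_proj (F (z k))) (frechet_derivative F (at (z k)) v)) \<le> C * norm v" for k
      using C[of "z k" v] norm_tangent_proj_le[OF norm_boundary_proj] by (auto intro: order_trans)
    then have "limsup (\<lambda>k. ereal (norm (tangent_proj (boundary_proj (F (z k)))
        (frechet_derivative F (at (z k)) v)))) \<le> ereal (C * norm v)"
      by (intro Limsup_bounded) simp
    also have "\<dots> < \<infinity>" by simp
    finally show "limsup (\<lambda>k. ereal (norm (tangent_proj (boundary_proj (F (z k)))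
        (frechet_derivative F (at (z k)) v)))) < \<infinity>" .
  next
    fix v :: "complex ^ 'n" and M :: real
    have k: "kobayashi unit_ball (F z) (frechet_derivative F (at z) v) = kobayashi unit_ball z v"
      if "norm z < 1" for z
      by (rule kobayashi_automorphism[OF hol self G that])
    show "(\<lambda>z. kobayashi unit_ball (F z) (frechet_derivative F (at z) v) - kobayashi unit_ball z v)
         \<in> o[at e1 within (nontang_region e1 M \<inter> complex_line v e1)](boundary_dist unit_ball)"
    \<comment> \<open>An automorphism preserves the metric, so the difference is 0 throughout the
      approach region, and 0 is little-o of anything.\<close>
    proof (subst landau_o.small.in_cong)
      show "\<forall>\<^sub>F z in at e1 within (nontang_region e1 M \<inter> complex_line v e1).
          kobayashi unit_ball (F z) (frechet_derivative F (at z) v) - kobayashi unit_ball z v = 0"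
        unfolding eventually_at
        by (intro exI[of _ 1]) (auto simp: nontang_region_def k)
    qed simp
  qed
qed

end
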